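(* Let $X$ be a real Banach space with $\dim X\ge2$. The condition $C_t^B(X)<2$ holds for one $t\in[-\infty,\infty)$ if and only if it holds for every $t\in[-\infty,\infty)$; and if it holds, then $X$ is super-reflexive and has the fixed point property for nonexpansive self-mappings on closed bounded convex subsets, i.e. for every nonempty closed bounded convex $K\subset X$, every map $T:K\to K$ with $\|Tx-Ty\|\le\|x-y\|$ for all $x,y\in K$ has a fixed point.
   Context: $S_X$ denotes the unit sphere of $X$. For $x,y\in X$, Birkhoff-James orthogonality $x\perp_B y$ means $\|x+\lambda y\|\ge\|x\|$ for all $\lambda\in\mathbb{R}$. For $a,b>0$ set $M_t(a,b)=\left(\frac{a^t+b^t}{2}\right)^{1/t}$ if $t\in\mathbb{R}\setminus\{0\}$, $M_0(a,b)=\sqrt{ab}$, and $M_{-\infty}(a,b)=\min\{a,b\}$. For $-\infty\le t<\infty$ and $\tau\ge 0$ define $$J^B_{X,t}(\tau)=\sup\{M_t(\|x+\tau y\|,\|x-\tau y\|): x,y\in S_X,\ x\perp_B y\},\qquad C^B_t(X)=\sup_{0\le\tau\le1}\frac{J^B_{X,t}(\tau)^2}{1+\tau^2}.$$ *)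

theory Defs
  imports "HOL-Analysis.Analysis"
begin

definition birkhoff_orth :: "'a::real_normed_vector \<Rightarrow> 'a \<Rightarrow> bool" where
  "birkhoff_orth x y \<longleftrightarrow> (\<forall>c::real. norm x \<le> norm (x + c *\<^sub>R y))"

text \<open>Power means of positive reals. Only parameters below \<open>\<infinity>\<close> are used; the value at \<open>\<infinity>\<close>
  merely completes the case distinction.\<close>

definition power_mean :: "ereal \<Rightarrow> real \<Rightarrow> real \<Rightarrow> real" where
  "power_mean t a b =
     (case t of
        ereal r \<Rightarrow> if r = 0 then sqrt (a * b) else ((a powr r + b powr r) / 2) powr (1 / r)
      | PInfty \<Rightarrow> max a b
      | MInfty \<Rightarrow> min a b)"

text \<open>For unit vectors with \<open>birkhoff_orth x y\<close> both norms below lie between \<open>1\<close> and \<open>1 + \<tau>\<close>,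
  so the means are taken of positive reals and the suprema are over sets bounded above. These sets
  are nonempty as soon as the space has dimension at least two.\<close>

definition JB :: "'a::real_normed_vector itself \<Rightarrow> ereal \<Rightarrow> real \<Rightarrow> real" where
  "JB _ t \<tau> =
     Sup {power_mean t (norm (x + \<tau> *\<^sub>R y)) (norm (x - \<tau> *\<^sub>R y)) | x y :: 'a.
            x \<in> sphere 0 1 \<and> y \<in> sphere 0 1 \<and> birkhoff_orth x y}"

definition CB :: "'a::real_normed_vector itself \<Rightarrow> ereal \<Rightarrow> real" where
  "CB X t = (SUP \<tau>\<in>{0..1}. (JB X t \<tau>)\<^sup>2 / (1 + \<tau>\<^sup>2))"

definition canonical_embedding :: "'a::real_normed_vector \<Rightarrow> (('a \<Rightarrow>\<^sub>L real) \<Rightarrow>\<^sub>L real)" where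
  "canonical_embedding x = Blinfun (\<lambda>f. blinfun_apply f x)"

lemma canonical_embedding_apply [simp]:
  "blinfun_apply (canonical_embedding x) f = blinfun_apply f x"
  by (simp add: canonical_embedding_def bounded_linear_Blinfun_apply blinfun.bounded_linear_left)

definition reflexive_space :: "'a::banach itself \<Rightarrow> bool" where
  "reflexive_space _ \<longleftrightarrow> surj (canonical_embedding :: 'a \<Rightarrow> ('a \<Rightarrow>\<^sub>L real) \<Rightarrow>\<^sub>L real)"

text \<open>Finite representability of the first space in the second, in the sense of James. The
  finite-dimensional subspaces are the spans of finite sets. A linear map on such a subspace always
  extends linearly to the whole space, and only its values on the subspace are constrained.\<close>

definition finitely_representable ::
    "'b::real_normed_vector itself \<Rightarrow> 'a::real_normed_vector itself \<Rightarrow> bool" where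
  "finitely_representable _ _ \<longleftrightarrow>
     (\<forall>B::'b set. \<forall>c::real. finite B \<and> 1 < c \<longrightarrow>
        (\<exists>T :: 'b \<Rightarrow> 'a. linear T \<and>
           (\<forall>y\<in>span B. norm y / c \<le> norm (T y) \<and> norm (T y) \<le> c * norm y)))"

text \<open>A Banach space is super-reflexive if every Banach space finitely representable in it is
  reflexive. A definition cannot quantify over types, so the test space is a second type argument.
  Super-reflexivity of \<open>'a\<close> is \<open>super_reflexive TYPE('a) TYPE('b)\<close> for a type variable \<open>'b\<close> that
  occurs nowhere else, in a positive position of a theorem.\<close>

definition super_reflexive :: "'a::banach itself \<Rightarrow> 'b::banach itself \<Rightarrow> bool" where
  "super_reflexive X Y \<longleftrightarrow> (finitely_representable Y X \<longrightarrow> reflexive_space Y)"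

definition fixed_point_property :: "'a::banach itself \<Rightarrow> bool" where
  "fixed_point_property _ \<longleftrightarrow>
     (\<forall>(K::'a set) (T::'a \<Rightarrow> 'a).
        K \<noteq> {} \<and> closed K \<and> bounded K \<and> convex K \<and> T \<in> K \<rightarrow> K \<and>
        (\<forall>x\<in>K. \<forall>y\<in>K. norm (T x - T y) \<le> norm (x - y)) \<longrightarrow>
        (\<exists>x\<in>K. T x = x))"

end

theory Submission
  imports Defs "HOL-Library.Ramsey"
begin

text \<open>Every condition \<open>C\<^sub>t\<^sup>B(X) < 2\<close> is equivalent to uniform non-squareness. If \<open>u\<close>, \<open>v\<close> almost span a
  square, the minimiser of \<open>norm (u + c v)\<close> over \<open>c\<close> is almost \<open>u\<close>, which gives a Birkhoff orthogonal
  almost square; conversely non-squareness bounds the mean by \<open>M\<^sub>t(1 + \<tau>, 1 + \<tau> - \<tau>\<delta>)\<close>, and \<open>\<tau>\<close> ranges over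
  a compact interval.

  Uniform non-squareness passes to finitely representable spaces, so super-reflexivity is James's
  theorem that uniformly non-square Banach spaces are reflexive. In a non-reflexive space Helly's
  theorem yields a ladder \<open>g\<^sub>i(x\<^sub>n) = \<theta>\<close> for \<open>i < n\<close> and \<open>0\<close> otherwise. By Ramsey's theorem the minimal
  norm \<open>c\<^sub>n\<close> of a vector whose values under the \<open>g\<^sub>i\<close> change sign along \<open>n\<close> blocks may be taken not to
  depend on the blocks. Interleaving two such vectors shows that \<open>c\<^sub>n\<close> grows geometrically unless
  there are almost squares, while \<open>c\<^sub>n = O(n)\<close> by the ladder.

  For the fixed point property let \<open>K\<close> be a minimal invariant set of diameter \<open>d > 0\<close>, \<open>x\<^sub>n\<close> an
  approximate fixed point sequence with weak limit \<open>p\<close>, and \<open>w\<^sub>n = (1 - \<mu>) (x\<^sub>n + p) / 2 + \<mu> T w\<^sub>n\<close> with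
  \<open>\<mu>\<close> close to \<open>1\<close> and weak limit \<open>z\<close>. Then \<open>z - p\<close> and \<open>w\<^sub>i - w\<^sub>m\<close> have norm about \<open>d / 2\<close> at most, while
  the Goebel-Karlovitz lemma gives \<open>norm (w\<^sub>n - p)\<close> close to \<open>d\<close>. Weak lower semicontinuity in \<open>m\<close> and
  Mazur's lemma in \<open>i\<close> then provide \<open>i\<close>, \<open>m\<close> for which \<open>z - p\<close> and \<open>w\<^sub>i - w\<^sub>m\<close> form an almost square.\<close>

section \<open>Hahn-Banach separation\<close>

definition sublinear :: "('a::real_vector \<Rightarrow> real) \<Rightarrow> bool" where
  "sublinear p \<longleftrightarrow> (\<forall>x y. p (x + y) \<le> p x + p y) \<and> (\<forall>a x. 0 \<le> a \<longrightarrow> p (a *\<^sub>R x) = a * p x)"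

lemma sublinear_add: "sublinear p \<Longrightarrow> p (x + y) \<le> p x + p y"
  by (simp add: sublinear_def)

lemma sublinear_scale: "sublinear p \<Longrightarrow> 0 \<le> a \<Longrightarrow> p (a *\<^sub>R x) = a * p x"
  by (simp add: sublinear_def)

lemma sublinear_zero: "sublinear p \<Longrightarrow> p 0 = 0"
  using sublinear_scale[of p 0 0] by simp

lemma sublinear_minus: "sublinear p \<Longrightarrow> - p (- x) \<le> p x"
  using sublinear_add[of p x "- x"] sublinear_zero[of p] by simp

lemma sublinearI:
  assumes add: "\<And>x y. p (x + y) \<le> p x + p y"
    and scale: "\<And>a x. 0 < a \<Longrightarrow> p (a *\<^sub>R x) \<le> a * p x" and zero: "p 0 = (0::real)"
  shows "sublinear p"
  unfolding sublinear_def
proof (intro conjI allI impI)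
  fix a :: real and x assume "0 \<le> a"
  show "p (a *\<^sub>R x) = a * p x"
  proof (cases "a = 0")
    case False
    with \<open>0 \<le> a\<close> have a: "0 < a" by simp
    have "p x \<le> inverse a * p (a *\<^sub>R x)"
      using scale[of "inverse a" "a *\<^sub>R x"] a by simp
    hence "a * p x \<le> p (a *\<^sub>R x)" using a by (simp add: field_simps)
    with scale[OF a, of x] show ?thesis by simp
  qed (use zero in simp)
qed (use add in auto)

text \<open>Both steps of the Hahn-Banach argument are instances of this lemma: a single vector
  \<open>C = {y}\<close> with \<open>\<beta> = q y\<close> shows that minimal sublinear functionals are linear, and
  \<open>C = {z - c}\<close> with \<open>q = norm\<close> gives the separation of a point from a convex set.\<close>

lemma sublinear_decrease:
  fixes q :: "'a::real_vector \<Rightarrow> real"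
  assumes q: "sublinear q" and C: "convex C" "C \<noteq> {}" and \<beta>: "\<And>c. c \<in> C \<Longrightarrow> \<beta> \<le> q c"
  obtains r where "sublinear r" "r \<le> q" "\<And>c. c \<in> C \<Longrightarrow> r (- c) \<le> - \<beta>"
proof -
  define I where "I = {0::real..} \<times> C"
  \<comment> \<open>In the infimum over \<open>t \<ge> 0\<close> and \<open>c \<in> C\<close>,
    \<open>t = 0\<close> gives \<open>r \<le> q\<close>, and \<open>t = 1\<close> at the argument
    \<open>- c\<close> gives \<open>r (- c) \<le> - \<beta>\<close>.\<close>
  define g where "g x i = q (x + fst i *\<^sub>R snd i) - fst i * \<beta>" for x and i :: "real \<times> 'a"
  define r where "r x = (INF i\<in>I. g x i)" for x
  have ne: "I \<noteq> {}" using C by (auto simp: I_def)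
  have lb: "- q (- x) \<le> g x i" if ii: "i \<in> I" for x i
  proof -
    obtain t c where i: "i = (t, c)" "0 \<le> t" "c \<in> C" using ii by (auto simp: I_def)
    have "t * \<beta> \<le> q (t *\<^sub>R c)" using \<beta>[OF i(3)] i(2) sublinear_scale[OF q i(2)] by (simp add: mult_left_mono)
    also have "\<dots> \<le> q (x + t *\<^sub>R c) + q (- x)" using sublinear_add[OF q, of "x + t *\<^sub>R c" "- x"] by simp
    finally show ?thesis by (simp add: g_def i)
  qed
  have bdd: "bdd_below (g x ` I)" for x using lb by (intro bdd_belowI2[where m = "- q (- x)"]) auto
  have le: "r x \<le> g x i" if "i \<in> I" for x i
    unfolding r_def by (rule cINF_lower[OF bdd that])
  have "sublinear r"
  proof (rule sublinearI)
    fix x y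
    have *: "r (x + y) \<le> g x i + g y j" if ij: "i \<in> I" "j \<in> I" for i j
    proof -
      obtain t c where i: "i = (t, c)" "0 \<le> t" "c \<in> C" using ij by (auto simp: I_def)
      obtain s e where j: "j = (s, e)" "0 \<le> s" "e \<in> C" using ij by (auto simp: I_def)
      obtain k where k: "(t + s, k) \<in> I" "(t + s) *\<^sub>R k = t *\<^sub>R c + s *\<^sub>R e"
      proof (cases "t + s = 0")
        case True
        then have "t = 0" "s = 0" using i j by auto
        then show ?thesis using that[of c] i by (auto simp: I_def)
      next
        case False
        define k where "k = (t / (t + s)) *\<^sub>R c + (s / (t + s)) *\<^sub>R e"
        have "k \<in> C" unfolding k_def using i j False C(1)
          by (intro convexD) (auto simp: add_divide_distrib[symmetric])
        moreover have "(t + s) *\<^sub>R k = t *\<^sub>R c + s *\<^sub>R e"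
          using False by (simp add: k_def scaleR_add_right)
        ultimately show ?thesis using that[of k] i j by (auto simp: I_def)
      qed
      have "r (x + y) \<le> q ((x + t *\<^sub>R c) + (y + s *\<^sub>R e)) - (t + s) * \<beta>"
        using le[OF k(1), of "x + y"] unfolding g_def fst_conv snd_conv k(2) by (simp add: add_ac)
      also have "\<dots> \<le> g x i + g y j"
        using sublinear_add[OF q, of "x + t *\<^sub>R c" "y + s *\<^sub>R e"]
        by (simp add: g_def i j algebra_simps)
      finally show ?thesis .
    qed
    have "r (x + y) - g y j \<le> r x" if "j \<in> I" for j
      unfolding r_def[of x] using * that by (intro cINF_greatest[OF ne]) (auto simp: algebra_simps)
    hence "r (x + y) - r x \<le> r y"
      unfolding r_def[of y] by (intro cINF_greatest[OF ne]) (force simp: algebra_simps)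
    thus "r (x + y) \<le> r x + r y" by simp
  next
    fix a :: real and x assume a: "0 < a"
    have "r (a *\<^sub>R x) / a \<le> g x i" if ii: "i \<in> I" for i
    proof -
      obtain t c where i: "i = (t, c)" "0 \<le> t" "c \<in> C" using ii by (auto simp: I_def)
      have "r (a *\<^sub>R x) \<le> g (a *\<^sub>R x) (a * t, c)" using a i by (intro le) (auto simp: I_def)
      also have "\<dots> = a * g x i"
        using sublinear_scale[OF q, of a "x + t *\<^sub>R c"] a by (simp add: g_def i algebra_simps)
      finally show ?thesis using a by (simp add: field_simps)
    qed
    hence "r (a *\<^sub>R x) / a \<le> r x" unfolding r_def[of x] by (intro cINF_greatest[OF ne])
    thus "r (a *\<^sub>R x) \<le> a * r x" using a by (simp add: field_simps)
  next
    obtain c where c: "c \<in> C" using C by auto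
    have "r 0 \<le> g 0 (0, c)" using c by (intro le) (auto simp: I_def)
    moreover have "0 \<le> r 0" unfolding r_def using lb[of _ 0] sublinear_zero[OF q]
      by (intro cINF_greatest[OF ne]) auto
    ultimately show "r 0 = 0" using sublinear_zero[OF q] by (simp add: g_def)
  qed
  moreover have "r \<le> q"
  proof (rule le_funI)
    fix x
    obtain c where c: "c \<in> C" using C by auto
    have "r x \<le> g x (0, c)" using c by (intro le) (auto simp: I_def)
    thus "r x \<le> q x" by (simp add: g_def)
  qed
  moreover have "r (- c) \<le> - \<beta>" if "c \<in> C" for c
  proof -
    have "r (- c) \<le> g (- c) (1, c)" using that by (intro le) (auto simp: I_def)
    thus ?thesis using sublinear_zero[OF q] by (simp add: g_def)
  qed
  ultimately show ?thesis using that by blast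
qed

text \<open>Zorn's lemma yields a minimal sublinear \<open>m\<close> below \<open>q\<close>. Being
  minimal, \<open>m\<close> is not changed by \<open>sublinear_decrease\<close>, so it is odd, and
  oddness turns subadditivity into additivity.\<close>

lemma sublinear_dominates_linear:
  fixes q :: "'a::real_vector \<Rightarrow> real"
  assumes q: "sublinear q"
  obtains f where "linear f" "f \<le> q"
proof -
  define A where "A = {p. sublinear p \<and> p \<le> q}"
  have "\<exists>m\<in>A. \<forall>a\<in>A. m \<ge> a \<longrightarrow> a = m"
  proof (rule predicate_Zorn)
    show "partial_order_on A (relation_of (\<lambda>x y. x \<ge> y) A)"
      by (rule partial_order_on_relation_ofI) auto
    fix Ch assume Ch: "Ch \<in> Chains (relation_of (\<lambda>x y. x \<ge> y) A)"
    hence sub: "Ch \<subseteq> A" and tot: "\<And>p p'. p \<in> Ch \<Longrightarrow> p' \<in> Ch \<Longrightarrow> p \<le> p' \<or> p' \<le> p"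
      by (auto simp: Chains_def relation_of_def)
    show "\<exists>u\<in>A. \<forall>a\<in>Ch. a \<ge> u"
    proof (cases "Ch = {}")
      case True
      thus ?thesis using q by (auto simp: A_def)
    next
      case ne: False
      define u where "u x = (INF p\<in>Ch. p x)" for x
      have sp: "sublinear p" "p x \<le> q x" if "p \<in> Ch" for p x
        using that sub by (auto simp: A_def le_fun_def)
      have lb: "- q (- x) \<le> p x" if "p \<in> Ch" for p x
        using sublinear_minus[OF sp(1)[OF that], of x] sp(2)[OF that, of "- x"] by simp
      have le: "u x \<le> p x" if "p \<in> Ch" for p x
        unfolding u_def using lb that by (intro cINF_lower bdd_belowI2[where m = "- q (- x)"]) auto
      have "sublinear u"
      proof (rule sublinearI)
        fix x y
        have *: "u (x + y) \<le> p x + p' y" if pp: "p \<in> Ch" "p' \<in> Ch" for p p'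
        proof -
          \<comment> \<open>A chain is directed downwards, so one member lies below both; this makes
            the pointwise infimum subadditive.\<close>
          obtain p0 where "p0 \<in> Ch" "p0 \<le> p" "p0 \<le> p'" using tot[OF pp] pp by blast
          thus ?thesis using le[of p0 "x + y"] sublinear_add[OF sp(1), of p0 x y]
            by (force simp: le_fun_def intro: order_trans add_mono)
        qed
        have "u (x + y) - p' y \<le> u x" if "p' \<in> Ch" for p'
          unfolding u_def[of x] using * that by (intro cINF_greatest[OF ne]) (auto simp: algebra_simps)
        hence "u (x + y) - u x \<le> u y"
          unfolding u_def[of y] by (intro cINF_greatest[OF ne]) (force simp: algebra_simps)
        thus "u (x + y) \<le> u x + u y" by simp
      next
        fix a :: real and x assume a: "0 < a"
        have "u (a *\<^sub>R x) / a \<le> u x" unfolding u_def[of x]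
        proof (rule cINF_greatest[OF ne])
          fix p assume p: "p \<in> Ch"
          show "u (a *\<^sub>R x) / a \<le> p x"
            using le[OF p, of "a *\<^sub>R x"] sublinear_scale[OF sp(1)[OF p], of a x] a by (simp add: field_simps)
        qed
        thus "u (a *\<^sub>R x) \<le> a * u x" using a by (simp add: field_simps)
      next
        show "u 0 = 0" unfolding u_def using ne sp(1)
          by (simp add: sublinear_zero cong: INF_cong)
      qed
      moreover obtain p where "p \<in> Ch" using ne by auto
      hence "u \<le> q" using le[of p] sp(2)[of p] by (auto intro!: le_funI intro: order_trans)
      ultimately show ?thesis using le by (auto simp: A_def le_fun_def)
    qed
  qed
  then obtain m where mA: "m \<in> A" and minA: "\<forall>a\<in>A. m \<ge> a \<longrightarrow> a = m" by blast
  from mA have m: "sublinear m" "m \<le> q" by (auto simp: A_def)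
  have min: "p = m" if "sublinear p" "p \<le> m" for p
    using minA that order_trans[OF that(2) m(2)] by (auto simp: A_def)
  have neg: "m (- y) = - m y" for y
  proof -
    obtain r where r: "sublinear r" "r \<le> m" "\<And>c. c \<in> {y} \<Longrightarrow> r (- c) \<le> - m y"
      by (rule sublinear_decrease[OF m(1), of "{y}" "m y"]) auto
    hence "m (- y) \<le> - m y" using min[of r] by auto
    thus ?thesis using sublinear_minus[OF m(1), of y] by simp
  qed
  have add: "m (x + y) = m x + m y" for x y
    using sublinear_add[OF m(1), of x y] sublinear_add[OF m(1), of "x + y" "- y"] neg[of y] by simp
  have "m (a *\<^sub>R x) = a * m x" for a x
    using sublinear_scale[OF m(1), of a x] sublinear_scale[OF m(1), of "- a" x] neg[of "a *\<^sub>R x"]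
    by (cases "0 \<le> a") auto
  hence "linear m" using add by (intro linearI) auto
  thus ?thesis using that m(2) by blast
qed

lemma convex_separation:
  fixes z :: "'a::real_normed_vector"
  assumes C: "convex C" "C \<noteq> {}" and d: "\<And>c. c \<in> C \<Longrightarrow> d \<le> norm (z - c)"
  obtains f :: "'a \<Rightarrow>\<^sub>L real" where "norm f \<le> 1" "\<And>c. c \<in> C \<Longrightarrow> f c + d \<le> f z"
proof -
  have "sublinear (norm :: 'a \<Rightarrow> real)" by (auto simp: sublinear_def norm_triangle_ineq)
  moreover have "convex ((\<lambda>c. z - c) ` C)" using convex_translation[OF convex_negations[OF C(1)], of z]
    by (simp add: image_image)
  ultimately obtain r :: "'a \<Rightarrow> real" where r: "sublinear r" "r \<le> norm" "\<And>c. c \<in> (\<lambda>c. z - c) ` C \<Longrightarrow> r (- c) \<le> - d"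
    using sublinear_decrease[of norm "(\<lambda>c. z - c) ` C" d] C d by auto
  obtain f where f: "linear f" "f \<le> r" using sublinear_dominates_linear[OF r(1)] .
  have fn: "f x \<le> norm x" for x using f(2) r(2) by (meson le_fun_def order_trans)
  have abs: "\<bar>f x\<bar> \<le> norm x" for x using fn[of x] fn[of "- x"] linear_neg[OF f(1), of x] by simp
  have bl: "bounded_linear f"
    using f(1) abs by (intro bounded_linear_intro[where K = 1]) (auto simp: linear_add linear_scale)
  define F where "F = Blinfun f"
  have F: "blinfun_apply F = f" using bl by (simp add: F_def bounded_linear_Blinfun_apply)
  have "norm F \<le> 1" using abs by (intro norm_blinfun_bound) (auto simp: F)
  moreover have "F c + d \<le> F z" if "c \<in> C" for c
  proof -
    have "f (- (z - c)) \<le> r (- (z - c))" using f(2) by (rule le_funD)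
    also have "\<dots> \<le> - d" using r(3) that by blast
    finally have "f (- (z - c)) \<le> - d" .
    thus ?thesis using linear_diff[OF f(1), of c z] by (simp add: F)
  qed
  ultimately show ?thesis using that by blast
qed

corollary norming_functional:
  fixes z :: "'a::real_normed_vector"
  obtains f :: "'a \<Rightarrow>\<^sub>L real" where "norm f \<le> 1" "f z = norm z"
proof -
  obtain f :: "'a \<Rightarrow>\<^sub>L real" where f: "norm f \<le> 1" "\<And>c. c \<in> {0} \<Longrightarrow> f c + norm z \<le> f z"
    using convex_separation[of "{0}" "norm z" z] by auto
  moreover have "f z \<le> norm z" using norm_blinfun[of f z] f(1)
    by (smt (verit) mult_left_le_one_le norm_ge_zero real_norm_def)
  ultimately show ?thesis using that[of f] by (auto simp: blinfun.zero_right)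
qed

corollary subspace_separation:
  fixes z :: "'a::real_normed_vector"
  assumes N: "subspace N" and d: "\<And>c. c \<in> N \<Longrightarrow> d \<le> norm (z - c)"
  obtains f :: "'a \<Rightarrow>\<^sub>L real" where "norm f \<le> 1" "\<And>c. c \<in> N \<Longrightarrow> f c = 0" "d \<le> f z"
proof -
  obtain f :: "'a \<Rightarrow>\<^sub>L real" where f: "norm f \<le> 1" "\<And>c. c \<in> N \<Longrightarrow> f c + d \<le> f z"
    using convex_separation[OF subspace_imp_convex[OF N], of d z] subspace_0[OF N] d by blast
  have "f c = 0" if c: "c \<in> N" for c
  proof (rule ccontr)
    assume "f c \<noteq> 0"
    \<comment> \<open>On \<open>N\<close> the functional is at most \<open>f z - d\<close>, but this
      vector has the value \<open>f z - d + 1\<close>.\<close>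
    moreover have "((f z - d + 1) / f c) *\<^sub>R c \<in> N" using c N by (rule subspace_scale[rotated])
    ultimately show False using f(2) by (fastforce simp: blinfun.scaleR_right)
  qed
  thus ?thesis using that f f(2)[OF subspace_0[OF N]] by (auto simp: blinfun.zero_right)
qed

section \<open>Helly's theorem\<close>

text \<open>Induction on \<open>I\<close>. If some \<open>v\<close> is annihilated by the
  \<open>\<phi> i\<close> with \<open>i \<in> I\<close> but not by \<open>\<phi> j\<close>, a
  multiple of \<open>\<phi> j\<close> is subtracted from \<open>\<psi>\<close> to make it vanish at
  \<open>v\<close>, and vectors are corrected along \<open>v\<close> to reach the kernel of
  \<open>\<phi> j\<close>. Otherwise adding \<open>j\<close> does not change the common
  kernel.\<close>

lemma linear_functional_in_span:
  fixes \<phi> :: "'i \<Rightarrow> 'a::real_vector \<Rightarrow> real"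
  assumes "finite I" and \<phi>: "\<And>i. i \<in> I \<Longrightarrow> linear (\<phi> i)" and "linear \<psi>"
    and "\<And>v. (\<And>i. i \<in> I \<Longrightarrow> \<phi> i v = 0) \<Longrightarrow> \<psi> v = 0"
  shows "\<exists>a. \<forall>v. \<psi> v = (\<Sum>i\<in>I. a i * \<phi> i v)"
  using assms
proof (induction I arbitrary: \<psi>)
  case (insert j I)
  show ?case
  proof (cases "\<exists>v. (\<forall>i\<in>I. \<phi> i v = 0) \<and> \<phi> j v \<noteq> 0")
    case True
    then obtain v where v: "\<And>i. i \<in> I \<Longrightarrow> \<phi> i v = 0" "\<phi> j v \<noteq> 0" by blast
    define b where "b = \<psi> v / \<phi> j v"
    have "\<exists>a. \<forall>x. \<psi> x - b * \<phi> j x = (\<Sum>i\<in>I. a i * \<phi> i x)"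
    proof (rule insert.IH)
      show "linear (\<lambda>x. \<psi> x - b * \<phi> j x)"
        using insert.prems(1)[of j] insert.prems(2)
        by (auto intro!: linearI simp: linear_add linear_scale algebra_simps)
      fix x assume x: "\<And>i. i \<in> I \<Longrightarrow> \<phi> i x = 0"
      define y where "y = x - (\<phi> j x / \<phi> j v) *\<^sub>R v"
      have "\<psi> y = 0"
      proof (rule insert.prems(3))
        fix i assume i: "i \<in> insert j I"
        have "\<phi> i y = \<phi> i x - (\<phi> j x / \<phi> j v) * \<phi> i v"
          using insert.prems(1)[OF i] by (simp add: y_def linear_diff linear_scale)
        thus "\<phi> i y = 0" using i x v by auto
      qed
      thus "\<psi> x - b * \<phi> j x = 0"
        using insert.prems(2) by (simp add: y_def b_def linear_diff linear_scale mult.commute)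
    qed (use insert.prems in auto)
    then obtain a where a: "\<And>x. \<psi> x - b * \<phi> j x = (\<Sum>i\<in>I. a i * \<phi> i x)" by blast
    have "\<psi> x = (\<Sum>i\<in>insert j I. (a(j := b)) i * \<phi> i x)" for x
    proof -
      have "(\<Sum>i\<in>I. (a(j := b)) i * \<phi> i x) = (\<Sum>i\<in>I. a i * \<phi> i x)"
        using insert.hyps by (intro sum.cong) auto
      thus ?thesis using a[of x] insert.hyps by simp
    qed
    thus ?thesis by blast
  next
    case False
    then obtain a where a: "\<And>x. \<psi> x = (\<Sum>i\<in>I. a i * \<phi> i x)"
      using insert.IH[of \<psi>] insert.prems by (metis insert_iff)
    have "\<psi> x = (\<Sum>i\<in>insert j I. (a(j := 0)) i * \<phi> i x)" for x
    proof -
      have "(\<Sum>i\<in>I. (a(j := 0)) i * \<phi> i x) = (\<Sum>i\<in>I. a i * \<phi> i x)"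
        using insert.hyps by (intro sum.cong) auto
      thus ?thesis using a[of x] insert.hyps by simp
    qed
    thus ?thesis by blast
  qed
qed auto

text \<open>A solution for \<open>I\<close> is corrected at \<open>j\<close> along a vector that
  only \<open>\<phi> j\<close> detects. If there is none, \<open>\<phi> j\<close> is a combination
  of the others, and the same relation among the \<open>c i\<close> forces the right value at
  \<open>j\<close>.\<close>

lemma linear_functionals_interpolation:
  fixes \<phi> :: "'i \<Rightarrow> 'a::real_vector \<Rightarrow> real"
  assumes "finite I" and "\<And>i. i \<in> I \<Longrightarrow> linear (\<phi> i)"
    and "\<And>a. (\<And>v. (\<Sum>i\<in>I. a i * \<phi> i v) = 0) \<Longrightarrow> (\<Sum>i\<in>I. a i * c i) = 0"
  shows "\<exists>v. \<forall>i\<in>I. \<phi> i v = c i"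
  using assms
proof (induction I)
  case (insert j I)
  have "\<exists>v. \<forall>i\<in>I. \<phi> i v = c i"
  proof (rule insert.IH)
    fix a assume a: "\<And>v. (\<Sum>i\<in>I. a i * \<phi> i v) = 0"
    have *: "(\<Sum>i\<in>insert j I. (a(j := 0)) i * h i) = (\<Sum>i\<in>I. a i * h i)" for h
    proof -
      have "(\<Sum>i\<in>I. (a(j := 0)) i * h i) = (\<Sum>i\<in>I. a i * h i)"
        using insert.hyps by (intro sum.cong) auto
      thus ?thesis using insert.hyps by simp
    qed
    show "(\<Sum>i\<in>I. a i * c i) = 0"
      using insert.prems(2)[of "a(j := 0)"] unfolding * using a by simp
  qed (use insert.prems in auto)
  then obtain v where v: "\<And>i. i \<in> I \<Longrightarrow> \<phi> i v = c i" by blast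
  have lin: "linear (\<phi> i)" if "i \<in> insert j I" for i using insert.prems(1) that .
  show ?case
  proof (cases "\<exists>u. (\<forall>i\<in>I. \<phi> i u = 0) \<and> \<phi> j u \<noteq> 0")
    case True
    then obtain u where u: "\<And>i. i \<in> I \<Longrightarrow> \<phi> i u = 0" "\<phi> j u \<noteq> 0" by blast
    have "\<phi> i (v + ((c j - \<phi> j v) / \<phi> j u) *\<^sub>R u) = c i" if "i \<in> insert j I" for i
      using that u v lin[OF that] by (auto simp: linear_add linear_scale)
    thus ?thesis by blast
  next
    case False
    then obtain a where a: "\<And>x. \<phi> j x = (\<Sum>i\<in>I. a i * \<phi> i x)"
      using linear_functional_in_span[of I \<phi> "\<phi> j"] insert.hyps insert.prems(1) by (metis insertCI)
    have *: "(\<Sum>i\<in>insert j I. (a(j := - 1)) i * h i) = (\<Sum>i\<in>I. a i * h i) - h j" for h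
    proof -
      have "(\<Sum>i\<in>I. (a(j := - 1)) i * h i) = (\<Sum>i\<in>I. a i * h i)"
        using insert.hyps by (intro sum.cong) auto
      thus ?thesis using insert.hyps by simp
    qed
    have "(\<Sum>i\<in>I. a i * c i) - c j = 0"
      using insert.prems(2)[of "a(j := - 1)"] unfolding * using a by simp
    moreover have "(\<Sum>i\<in>I. a i * \<phi> i v) = (\<Sum>i\<in>I. a i * c i)" using v by (intro sum.cong) auto
    ultimately have "\<phi> j v = c j" using a[of v] by simp
    thus ?thesis using v by auto
  qed
qed auto

text \<open>If all solutions had norm above \<open>M + e\<close>, a functional of norm at most
  \<open>1\<close> would vanish on the common kernel and be at least \<open>M + e\<close> at a
  solution \<open>y\<close>. It is a combination of the \<open>\<phi> i\<close>, so
  \<open>le\<close> bounds its value at \<open>y\<close> by \<open>M\<close>.\<close>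

theorem helly_interpolation:
  fixes \<phi> :: "'i \<Rightarrow> 'a::real_normed_vector \<Rightarrow>\<^sub>L real"
  assumes I: "finite I" and M: "0 \<le> M" and e: "0 < e"
    and le: "\<And>a. \<bar>\<Sum>i\<in>I. a i * c i\<bar> \<le> M * norm (\<Sum>i\<in>I. a i *\<^sub>R \<phi> i)"
  obtains x where "norm x \<le> M + e" "\<And>i. i \<in> I \<Longrightarrow> \<phi> i x = c i"
proof -
  have lin: "linear (blinfun_apply (\<phi> i))" for i
    by (intro linearI) (auto simp: blinfun.add_right blinfun.scaleR_right)
  have app: "blinfun_apply (\<Sum>i\<in>I. a i *\<^sub>R \<phi> i) v = (\<Sum>i\<in>I. a i * \<phi> i v)" for a v
    by (simp add: blinfun.sum_left blinfun.scaleR_left)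
  have "\<exists>y. \<forall>i\<in>I. \<phi> i y = c i"
  proof (rule linear_functionals_interpolation[OF I lin])
    fix a assume "\<And>v. (\<Sum>i\<in>I. a i * \<phi> i v) = 0"
    hence "(\<Sum>i\<in>I. a i *\<^sub>R \<phi> i) = 0" by (intro blinfun_eqI) (simp only: app blinfun.zero_left)
    thus "(\<Sum>i\<in>I. a i * c i) = 0" using le[of a] by simp
  qed
  then obtain y where y: "\<And>i. i \<in> I \<Longrightarrow> \<phi> i y = c i" by blast
  define N where "N = {v. \<forall>i\<in>I. \<phi> i v = 0}"
  have N: "subspace N"
    by (auto simp: N_def subspace_def blinfun.add_right blinfun.scaleR_right)
  have "\<exists>n\<in>N. norm (y - n) \<le> M + e"
  proof (rule ccontr)
    assume "\<not> ?thesis"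
    hence "M + e \<le> norm (y - n)" if "n \<in> N" for n using that by force
    then obtain f :: "'a \<Rightarrow>\<^sub>L real" where f: "norm f \<le> 1" "\<And>n. n \<in> N \<Longrightarrow> f n = 0" "M + e \<le> f y"
      using subspace_separation[OF N] by metis
    obtain a where a: "\<And>v. f v = (\<Sum>i\<in>I. a i * \<phi> i v)"
    proof -
      have "linear (blinfun_apply f)"
        by (intro linearI) (auto simp: blinfun.add_right blinfun.scaleR_right)
      hence "\<exists>a. \<forall>v. f v = (\<Sum>i\<in>I. a i * \<phi> i v)"
        using f(2) by (intro linear_functional_in_span[OF I lin]) (auto simp: N_def)
      thus ?thesis using that by blast
    qed
    have "f = (\<Sum>i\<in>I. a i *\<^sub>R \<phi> i)" by (rule blinfun_eqI) (simp only: app a)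
    hence "M * norm (\<Sum>i\<in>I. a i *\<^sub>R \<phi> i) \<le> M" using f(1) M by (simp add: mult_left_le)
    moreover have "f y = (\<Sum>i\<in>I. a i * c i)" unfolding a using y by (intro sum.cong) auto
    ultimately show False using le[of a] f(3) e by linarith
  qed
  then obtain n where "n \<in> N" "norm (y - n) \<le> M + e" by blast
  thus ?thesis using that[of "y - n"] y by (simp add: N_def blinfun.diff_right)
qed

section \<open>Ladders in non-reflexive spaces\<close>

lemma norm_canonical_embedding [simp]: "norm (canonical_embedding x) = norm x"
proof (rule antisym)
  have "\<bar>f x\<bar> \<le> norm x * norm f" for f :: "'a \<Rightarrow>\<^sub>L real"
    using norm_blinfun[of f x] by (simp add: mult.commute)
  thus "norm (canonical_embedding x) \<le> norm x" by (intro norm_blinfun_bound) auto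
  obtain f :: "'a \<Rightarrow>\<^sub>L real" where f: "norm f \<le> 1" "f x = norm x" by (rule norming_functional)
  have "norm x \<le> norm (canonical_embedding x) * norm f"
    using norm_blinfun[of "canonical_embedding x" f] f by simp
  also have "\<dots> \<le> norm (canonical_embedding x)" using f(1) by (simp add: mult_left_le)
  finally show "norm x \<le> norm (canonical_embedding x)" .
qed

lemma bounded_linear_canonical_embedding: "bounded_linear canonical_embedding"
proof (rule bounded_linear_intro[where K = 1])
  show "canonical_embedding (x + y) = canonical_embedding x + canonical_embedding y" for x y :: 'a
    by (rule blinfun_eqI) (simp add: blinfun.add_left blinfun.add_right)
  show "canonical_embedding (r *\<^sub>R x) = r *\<^sub>R canonical_embedding x" for r and x :: 'a
    by (rule blinfun_eqI) (simp add: blinfun.scaleR_left blinfun.scaleR_right)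
qed simp

lemmas canonical_embedding_linear_simps =
  linear_scale[OF bounded_linear.linear[OF bounded_linear_canonical_embedding]]
  linear_neg[OF bounded_linear.linear[OF bounded_linear_canonical_embedding]]
  linear_sum[OF bounded_linear.linear[OF bounded_linear_canonical_embedding]]

lemma closed_range_canonical_embedding:
  "closed (range (canonical_embedding :: 'a::banach \<Rightarrow> _))"
proof -
  have "complete (range (canonical_embedding :: 'a \<Rightarrow> _))"
    by (rule complete_isometric_image[of 1]) (auto simp: bounded_linear_canonical_embedding complete_UNIV)
  thus ?thesis by (rule complete_imp_closed)
qed

text \<open>Pairs of \<open>x n\<close> and \<open>g n\<close> are built recursively from some
  \<open>\<Phi>\<close> in the bidual outside the canonical image. Helly's theorem gives
  \<open>x n\<close> imitating \<open>\<Phi>\<close> on the earlier \<open>g i\<close>; applied in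
  the dual, it gives \<open>g n\<close> with \<open>\<Phi> (g n) = \<theta>\<close> that annihilates
  \<open>x 0\<close>, ..., \<open>x n\<close>.\<close>

lemma nonreflexive_ladder:
  assumes "\<not> reflexive_space TYPE('a::banach)"
  obtains M \<theta> :: real and x :: "nat \<Rightarrow> 'a::banach" and g :: "nat \<Rightarrow> 'a::banach \<Rightarrow>\<^sub>L real"
  where "0 < \<theta>" "\<And>n. norm (x n) \<le> M" "\<And>n. norm (g n) \<le> 1"
    "\<And>i n. i < n \<Longrightarrow> g i (x n) = \<theta>" "\<And>i n. n \<le> i \<Longrightarrow> g i (x n) = 0"
proof -
  obtain \<Phi> :: "('a \<Rightarrow>\<^sub>L real) \<Rightarrow>\<^sub>L real" where \<Phi>: "\<Phi> \<notin> range canonical_embedding"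
    using assms by (auto simp: reflexive_space_def)
  define d where "d = infdist \<Phi> (range (canonical_embedding :: 'a \<Rightarrow> _))"
  have "d \<noteq> 0" using in_closed_iff_infdist_zero[OF closed_range_canonical_embedding] \<Phi> by (auto simp: d_def)
  hence d: "0 < d" using infdist_nonneg[of \<Phi>] by (simp add: d_def order_less_le)
  have dist: "\<bar>a\<bar> * d \<le> norm (a *\<^sub>R \<Phi> + canonical_embedding v)" for a v
  proof (cases "a = 0")
    case False
    have "d \<le> dist \<Phi> (canonical_embedding (- v /\<^sub>R a))" unfolding d_def by (rule infdist_le) auto
    also have "\<dots> = norm (\<Phi> + canonical_embedding v /\<^sub>R a)"
      by (simp add: dist_norm canonical_embedding_linear_simps)
    finally have "\<bar>a\<bar> * d \<le> \<bar>a\<bar> * norm (\<Phi> + canonical_embedding v /\<^sub>R a)" by (simp add: mult_left_mono)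
    also have "\<dots> = norm (a *\<^sub>R (\<Phi> + canonical_embedding v /\<^sub>R a))" by simp
    finally show ?thesis using False by (simp add: scaleR_add_right)
  qed auto
  \<comment> \<open>Half the distance: Helly's theorem for \<open>g\<close> then holds with constant
    \<open>1 / 2\<close>, and the slack \<open>1 / 2\<close> still keeps the norm at most
    \<open>1\<close>.\<close>
  define \<theta> where "\<theta> = d / 2"
  define M where "M = norm \<Phi> + 1"
  define P where "P s n r \<longleftrightarrow> norm (fst r) \<le> M \<and> norm (snd r) \<le> 1 \<and> \<Phi> (snd r) = \<theta> \<and>
      (\<forall>i<n. blinfun_apply (snd (s i)) (fst r) = \<theta>) \<and> (\<forall>i<n. blinfun_apply (snd r) (fst (s i)) = 0) \<and>
      blinfun_apply (snd r) (fst r) = 0"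
    for s :: "nat \<Rightarrow> 'a \<times> ('a \<Rightarrow>\<^sub>L real)" and n :: nat and r
  have "\<exists>s. \<forall>n. P s n (s n)"
  proof (rule dependent_wellorder_choice)
    fix n :: nat and s :: "nat \<Rightarrow> 'a \<times> ('a \<Rightarrow>\<^sub>L real)" assume prev: "\<And>i. i < n \<Longrightarrow> P s i (s i)"
    obtain x where x: "norm x \<le> norm \<Phi> + 1" "\<And>i. i \<in> {..<n} \<Longrightarrow> snd (s i) x = \<theta>"
    proof (rule helly_interpolation)
      fix a :: "nat \<Rightarrow> real"
      have "(\<Sum>i<n. a i * \<theta>) = (\<Sum>i<n. a i * \<Phi> (snd (s i)))"
        using prev by (intro sum.cong) (auto simp: P_def)
      also have "\<dots> = \<Phi> (\<Sum>i<n. a i *\<^sub>R snd (s i))"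
        by (simp add: blinfun.sum_right blinfun.scaleR_right)
      finally show "\<bar>\<Sum>i<n. a i * \<theta>\<bar> \<le> norm \<Phi> * norm (\<Sum>i<n. a i *\<^sub>R snd (s i))"
        using norm_blinfun[of \<Phi> "\<Sum>i<n. a i *\<^sub>R snd (s i)"] by simp
    qed auto
    define y where "y = (fst \<circ> s)(n := x)"
    define \<phi> where "\<phi> i = (case i of 0 \<Rightarrow> \<Phi> | Suc m \<Rightarrow> canonical_embedding (y m))" for i
    obtain g where g: "norm g \<le> 1 / 2 + 1 / 2"
      "\<And>i. i \<in> {..Suc n} \<Longrightarrow> \<phi> i g = (case i of 0 \<Rightarrow> \<theta> | Suc m \<Rightarrow> 0)"
    proof (rule helly_interpolation[where M = "1 / 2" and e = "1 / 2"])
      fix a :: "nat \<Rightarrow> real"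
      have s1: "(\<Sum>i\<le>Suc n. a i *\<^sub>R \<phi> i) = a 0 *\<^sub>R \<Phi> + canonical_embedding (\<Sum>i\<le>n. a (Suc i) *\<^sub>R y i)"
        by (simp add: sum.atMost_Suc_shift \<phi>_def canonical_embedding_linear_simps
            del: sum.atMost_Suc)
      have s2: "(\<Sum>i\<le>Suc n. a i * (case i of 0 \<Rightarrow> \<theta> | Suc m \<Rightarrow> 0)) = a 0 * \<theta>"
        by (simp add: sum.atMost_Suc_shift del: sum.atMost_Suc)
      show "\<bar>\<Sum>i\<le>Suc n. a i * (case i of 0 \<Rightarrow> \<theta> | Suc m \<Rightarrow> 0)\<bar>
          \<le> 1 / 2 * norm (\<Sum>i\<le>Suc n. a i *\<^sub>R \<phi> i)"
        unfolding s1 s2 using dist[of "a 0"] d by (simp add: \<theta>_def abs_mult)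
    qed auto
    have "\<Phi> g = \<theta>" using g(2)[of 0] by (simp add: \<phi>_def)
    moreover have "blinfun_apply g (y m) = 0" if "m \<le> n" for m
      using g(2)[of "Suc m"] that by (simp add: \<phi>_def)
    hence "blinfun_apply g (fst (s m)) = 0" if "m < n" for m 
      using that by (metis comp_apply fun_upd_other less_imp_le less_irrefl y_def)
    moreover have "blinfun_apply g x = 0"
      using \<open>\<And>m. m \<le> n \<Longrightarrow> blinfun_apply g (y m) = 0\<close>[of n] by (simp add: y_def)
    ultimately have "P s n (x, g)" using x g(1) by (simp add: P_def M_def)
    thus "\<exists>r. P s n r" by blast
  qed (simp add: P_def)
  then obtain s where s: "\<And>n. P s n (s n)" by blast
  show ?thesis
  proof (rule that)
    show "0 < \<theta>" using d by (simp add: \<theta>_def)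
    show "norm (fst (s n)) \<le> M" "norm (snd (s n)) \<le> 1" for n using s by (auto simp: P_def)
    show "blinfun_apply (snd (s i)) (fst (s n)) = \<theta>" if "i < n" for i n using s[of n] that by (auto simp: P_def)
    show "blinfun_apply (snd (s i)) (fst (s n)) = 0" if "n \<le> i" for i n
      using s[of i] that by (cases "n = i") (auto simp: P_def)
  qed
qed

section \<open>Uniformly non-square spaces are reflexive\<close>

definition uniformly_nonsquare :: "'a::real_normed_vector itself \<Rightarrow> bool" where
  "uniformly_nonsquare _ \<longleftrightarrow> (\<exists>\<delta>>0. \<forall>x y::'a. norm x \<le> 1 \<longrightarrow> norm y \<le> 1 \<longrightarrow>
     norm (x + y) \<le> 2 - \<delta> \<or> norm (x - y) \<le> 2 - \<delta>)"

text \<open>Homogeneity replaces the unit ball by any ball; the cap \<open>\<delta> \<le> 1\<close>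
  keeps later factors such as \<open>1 - \<delta> / 4\<close> positive.\<close>

lemma uniformly_nonsquare_scaled:
  assumes "uniformly_nonsquare TYPE('a::real_normed_vector)"
  shows "\<exists>\<delta>>0. \<delta> \<le> 1 \<and> (\<forall>r (x::'a) y. norm x \<le> r \<longrightarrow> norm y \<le> r \<longrightarrow>
     norm (x + y) \<le> (2 - \<delta>) * r \<or> norm (x - y) \<le> (2 - \<delta>) * r)"
proof -
  obtain e where e: "0 < e" "\<And>x y::'a. norm x \<le> 1 \<Longrightarrow> norm y \<le> 1 \<Longrightarrow>
     norm (x + y) \<le> 2 - e \<or> norm (x - y) \<le> 2 - e"
    using assms by (auto simp: uniformly_nonsquare_def)
  define \<delta> where "\<delta> = min e 1"
  have "norm (x + y) \<le> (2 - \<delta>) * r \<or> norm (x - y) \<le> (2 - \<delta>) * r"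
    if xy: "norm x \<le> r" "norm y \<le> r" for r and x y :: 'a
  proof (cases "r = 0")
    case False
    hence r: "0 < r" using xy(1) norm_ge_zero[of x] by linarith
    have *: "norm (x /\<^sub>R r + y /\<^sub>R r) = norm (x + y) / r" "norm (x /\<^sub>R r - y /\<^sub>R r) = norm (x - y) / r"
      using r by (simp_all add: scaleR_add_right[symmetric] scaleR_diff_right[symmetric] divide_inverse_commute)
    have "norm (x /\<^sub>R r + y /\<^sub>R r) \<le> 2 - \<delta> \<or> norm (x /\<^sub>R r - y /\<^sub>R r) \<le> 2 - \<delta>"
      using e(2)[of "x /\<^sub>R r" "y /\<^sub>R r"] xy r by (auto simp: \<delta>_def field_simps)
    thus ?thesis using r unfolding * by (simp add: field_simps)
  qed (use xy in auto)
  thus ?thesis using e(1) by (intro exI[of _ \<delta>]) (auto simp: \<delta>_def)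
qed

section \<open>Vectors with alternating signs along blocks of functionals\<close>

text \<open>Nothing is required of \<open>g k\<close> for \<open>k\<close> between two blocks: sums
  and differences of interleaved vectors are controlled only where blocks overlap, and still lie in
  a set of this kind.\<close>

definition alternating :: "(nat \<Rightarrow> 'a::real_normed_vector \<Rightarrow>\<^sub>L real) \<Rightarrow> nat \<Rightarrow> (nat \<Rightarrow> nat) \<Rightarrow> 'a set" where
  "alternating g n p = {x. \<forall>i<n. \<forall>k. p (2 * i) \<le> k \<and> k < p (2 * i + 1) \<longrightarrow> 1 \<le> (- 1) ^ i * g k x}"

definition alternating_norm :: "(nat \<Rightarrow> 'a::real_normed_vector \<Rightarrow>\<^sub>L real) \<Rightarrow> nat \<Rightarrow> (nat \<Rightarrow> nat) \<Rightarrow> real" where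
  "alternating_norm g n p = Inf (norm ` alternating g n p)"

lemma alternating_norm_le: "x \<in> alternating g n p \<Longrightarrow> alternating_norm g n p \<le> norm x"
  unfolding alternating_norm_def by (intro cInf_lower imageI bdd_belowI2[where m = 0]) auto

lemma alternating_norm_less:
  assumes "alternating_norm g n p < c" "alternating g n p \<noteq> {}"
  obtains x where "x \<in> alternating g n p" "norm x < c"
proof -
  have "\<exists>r\<in>norm ` alternating g n p. r < c"
    using assms unfolding alternating_norm_def by (intro cInf_lessD) auto
  thus ?thesis using that by auto
qed

lemma alternating_norm_ge_1:
  assumes g: "\<And>k. norm (g k) \<le> 1" and p: "strict_mono p" and n: "0 < n" and ne: "alternating g n p \<noteq> {}"
  shows "1 \<le> alternating_norm g n p"
  unfolding alternating_norm_def
proof (rule cInf_greatest)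
  fix r assume "r \<in> norm ` alternating g n p"
  then obtain x where x: "r = norm x" "x \<in> alternating g n p" by auto
  have "p 0 < p 1" using p by (simp add: strict_monoD)
  moreover have "\<forall>k. p (2 * 0) \<le> k \<and> k < p (2 * 0 + 1) \<longrightarrow> 1 \<le> (- 1) ^ 0 * g k x"
    using x(2) n unfolding alternating_def by blast
  ultimately have "1 \<le> g (p 0) x" by simp
  also have "\<dots> \<le> norm (g (p 0)) * norm x" using norm_blinfun[of "g (p 0)" x] by simp
  also have "\<dots> \<le> 1 * norm x" using g by (intro mult_right_mono) auto
  finally show "1 \<le> r" by (simp add: x(1))
qed (use ne in auto)

text \<open>Under \<open>g k\<close> the difference \<open>x (p (2 * i + 1)) - x (p (2 * i))\<close>
  is \<open>\<theta>\<close> if \<open>k\<close> lies in the \<open>i\<close>-th block and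
  \<open>0\<close> otherwise. A signed sum of these, divided by \<open>\<theta>\<close>, costs at
  most \<open>2 * M / \<theta>\<close> per block.\<close>

lemma ladder_alternating:
  fixes g :: "nat \<Rightarrow> 'a::real_normed_vector \<Rightarrow>\<^sub>L real"
  assumes \<theta>: "0 < \<theta>" and x: "\<And>n. norm (x n) \<le> M"
    and lt: "\<And>i n. i < n \<Longrightarrow> g i (x n) = \<theta>" and ge: "\<And>i n. n \<le> i \<Longrightarrow> g i (x n) = 0" and p: "strict_mono p"
  shows "\<exists>z\<in>alternating g n p. norm z \<le> 2 * M / \<theta> * real n"
proof -
  define u where "u i = x (p (2 * i + 1)) - x (p (2 * i))" for i
  define z where "z = (\<Sum>i<n. ((- 1) ^ i / \<theta>) *\<^sub>R u i)"
  have gu: "g k (u i) = (if p (2 * i) \<le> k \<and> k < p (2 * i + 1) then \<theta> else 0)" for k i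
  proof -
    have "p (2 * i) < p (2 * i + 1)" using p by (simp add: strict_monoD)
    moreover have "g k (x m) = (if k < m then \<theta> else 0)" for m using lt ge by (auto simp: not_less)
    ultimately show ?thesis by (auto simp: u_def blinfun.diff_right)
  qed
  have "z \<in> alternating g n p"
    unfolding alternating_def
  proof (intro CollectI allI impI)
    fix i k assume i: "i < n" and k: "p (2 * i) \<le> k \<and> k < p (2 * i + 1)"
    have "g k (u j) = 0" if "j \<noteq> i" for j
    proof (cases "j < i")
      case True
      hence "p (2 * j + 1) < p (2 * i)" by (intro strict_monoD[OF p]) auto
      thus ?thesis using k by (auto simp: gu)
    next
      case False
      hence "p (2 * i + 1) < p (2 * j)" using that by (intro strict_monoD[OF p]) auto
      thus ?thesis using k by (auto simp: gu)
    qed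
    hence "g k z = (\<Sum>j<n. if j = i then (- 1) ^ i else 0)"
      unfolding z_def blinfun.sum_right using k \<theta> by (intro sum.cong) (auto simp: blinfun.scaleR_right gu)
    thus "1 \<le> (- 1) ^ i * g k z" using i by (simp flip: power_mult_distrib)
  qed
  moreover have "norm z \<le> (\<Sum>i<n. 2 * M / \<theta>)"
    unfolding z_def
  proof (rule sum_norm_le)
    fix i
    have "norm (u i) \<le> 2 * M"
      using norm_triangle_ineq4[of "x (p (2 * i + 1))" "x (p (2 * i))"] x[of "p (2 * i + 1)"] x[of "p (2 * i)"]
      by (simp add: u_def)
    thus "norm (((- 1) ^ i / \<theta>) *\<^sub>R u i) \<le> 2 * M / \<theta>" using \<theta> by (simp add: power_abs divide_right_mono)
  qed
  ultimately show ?thesis by (auto simp: mult.commute)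
qed

section \<open>Stabilisation by Ramsey's theorem\<close>

text \<open>Ramsey's theorem is applied for one \<open>n\<close> after the other, each time inside
  the homogeneous set found before.\<close>

lemma Ramsey_simultaneous:
  fixes f :: "nat \<Rightarrow> nat set \<Rightarrow> nat" and r s :: "nat \<Rightarrow> nat"
  assumes "\<And>n X. finite X \<Longrightarrow> card X = r n \<Longrightarrow> f n X < s n"
  shows "\<exists>H t. infinite H \<and> (\<forall>n<N. \<forall>X. X \<subseteq> H \<and> finite X \<and> card X = r n \<longrightarrow> f n X = t n)"
proof (induction N)
  case 0
  show ?case using infinite_UNIV_nat by blast
next
  case (Suc N)
  then obtain H t where H: "infinite H" "\<And>n X. n < N \<Longrightarrow> X \<subseteq> H \<Longrightarrow> finite X \<Longrightarrow> card X = r n \<Longrightarrow> f n X = t n"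
    by blast
  have "\<forall>X. X \<subseteq> H \<and> finite X \<and> card X = r N \<longrightarrow> f N X < s N" using assms by simp
  from Ramsey[OF H(1) this] obtain Y k where Y: "Y \<subseteq> H" "infinite Y"
    and k: "\<forall>X. X \<subseteq> Y \<and> finite X \<and> card X = r N \<longrightarrow> f N X = k"
    by (elim exE conjE) (rule that)
  have "\<forall>n<Suc N. \<forall>X. X \<subseteq> Y \<and> finite X \<and> card X = r n \<longrightarrow> f n X = (t(N := k)) n"
    using H(2) Y(1) k by (simp add: less_Suc_eq) (meson order_trans)
  thus ?case using Y(2) by blast
qed

text \<open>The minimal norm depends only on the first \<open>2 * n\<close> values of
  \<open>p\<close>. Rounded down to multiples of \<open>\<eta>\<close> it colours the sets of
  \<open>2 * n\<close> numbers, with finitely many colours by the bound \<open>C * real n\<close>;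
  \<open>h\<close> enumerates a set homogeneous for all \<open>n < N\<close>.\<close>

lemma alternating_norm_stable:
  fixes g :: "nat \<Rightarrow> 'a::real_normed_vector \<Rightarrow>\<^sub>L real"
  assumes \<eta>: "0 < \<eta>"
    and ex: "\<And>n p. strict_mono p \<Longrightarrow> \<exists>z\<in>alternating g n p. norm z \<le> C * real n"
  obtains h :: "nat \<Rightarrow> nat" and c :: "nat \<Rightarrow> real" where "strict_mono h"
    "\<And>n a. n < N \<Longrightarrow> strict_mono a \<Longrightarrow>
       c n \<le> alternating_norm g n (h \<circ> a) \<and> alternating_norm g n (h \<circ> a) < c n + \<eta>"
proof -
  \<comment> \<open>Only the first \<open>card X\<close> values matter; the others merely make \<open>P X\<close> strictly increasing.\<close>
  define P where "P X i = (if i < card X then sorted_list_of_set X ! i else Max (insert 0 X) + i + 1)" for X and i :: nat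
  define f where "f n X = nat \<lfloor>alternating_norm g n (P X) / \<eta>\<rfloor>" for n X
  have P: "strict_mono (P X)" if "finite X" for X
  proof (rule strict_monoI)
    fix i j :: nat assume ij: "i < j"
    have mem: "sorted_list_of_set X ! k \<in> X" if "k < card X" for k
      using that \<open>finite X\<close> by (metis length_sorted_list_of_set nth_mem set_sorted_list_of_set)
    show "P X i < P X j"
    proof (cases "j < card X")
      case True
      thus ?thesis using ij sorted_wrt_nth_less[OF strict_sorted_list_of_set, of i j X]
        by (simp add: P_def)
    next
      case False
      thus ?thesis using ij mem[of i] \<open>finite X\<close> by (auto simp: P_def Max_insert2 le_imp_less_Suc trans_le_add1)
    qed
  qed
  have nn: "0 \<le> alternating_norm g n p" if p: "strict_mono p" for n p
    unfolding alternating_norm_def using ex[OF p, of n] by (intro cInf_greatest) auto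
  have "f n X < nat \<lfloor>C * real n / \<eta>\<rfloor> + 1" if X: "finite X" for n X
  proof -
    obtain z where "z \<in> alternating g n (P X)" "norm z \<le> C * real n" using ex[OF P[OF X]] by blast
    hence "alternating_norm g n (P X) \<le> C * real n" using alternating_norm_le by fastforce
    hence "\<lfloor>alternating_norm g n (P X) / \<eta>\<rfloor> \<le> \<lfloor>C * real n / \<eta>\<rfloor>"
      using \<eta> by (intro floor_mono divide_right_mono) auto
    thus ?thesis by (auto simp: f_def nat_mono le_imp_less_Suc)
  qed
  hence "\<exists>H t. infinite H \<and> (\<forall>n<N. \<forall>X. X \<subseteq> H \<and> finite X \<and> card X = 2 * n \<longrightarrow> f n X = t n)"
    by (rule Ramsey_simultaneous)
  then obtain H t where H: "infinite H"
    and Ht: "\<forall>n<N. \<forall>X. X \<subseteq> H \<and> finite X \<and> card X = 2 * n \<longrightarrow> f n X = t n"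
    by (elim exE conjE) (rule that)
  define h where "h = enumerate H"
  have h: "strict_mono h" unfolding h_def by (rule strict_mono_enumerate[OF H])
  show ?thesis
  proof (rule that[OF h, of "\<lambda>n. \<eta> * real (t n)"])
    fix n a assume n: "n < N" and a: "strict_mono (a :: nat \<Rightarrow> nat)"
    define p where "p = h \<circ> a"
    have p: "strict_mono p" unfolding p_def using h a by (rule strict_mono_o)
    define X where "X = p ` {..<2 * n}"
    have X: "finite X" "card X = 2 * n" "X \<subseteq> H"
      using enumerate_in_set[OF H] card_image[OF strict_mono_imp_inj_on[OF p], of "{..<2 * n}"]
      by (auto simp: X_def p_def h_def)
    have "sorted_list_of_set X = map p [0..<2 * n]"
    proof (rule sorted_distinct_set_unique)
      show "sorted (map p [0..<2 * n])"
        using p by (intro sorted_wrt_map_mono[OF sorted_upt]) (auto simp: strict_mono_less_eq)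
      show "distinct (map p [0..<2 * n])"
        using strict_mono_imp_inj_on[OF p] by (auto simp: distinct_map inj_on_subset)
    qed (auto simp: X_def atLeast0LessThan)
    hence Pp: "P X i = p i" if "i < 2 * n" for i using that X by (simp add: P_def)
    have "alternating g n (P X) = alternating g n p"
      by (auto simp: alternating_def Pp)
    hence eq: "alternating_norm g n (P X) = alternating_norm g n p" by (simp add: alternating_norm_def)
    have "int (t n) = \<lfloor>alternating_norm g n p / \<eta>\<rfloor>"
      using Ht[rule_format, OF n conjI[OF X(3) conjI[OF X(1,2)]]] nn[OF p, of n] \<eta> by (simp add: f_def eq nat_eq_iff)
    hence "real (t n) \<le> alternating_norm g n p / \<eta>" "alternating_norm g n p / \<eta> < real (t n) + 1"
      by linarith+
    thus "\<eta> * real (t n) \<le> alternating_norm g n (h \<circ> a) \<and> alternating_norm g n (h \<circ> a) < \<eta> * real (t n) + \<eta>"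
      using \<eta> by (simp add: p_def field_simps)
  qed
qed

lemma alternatingI:
  fixes g :: "nat \<Rightarrow> 'a::real_normed_vector \<Rightarrow>\<^sub>L real"
  shows "(\<And>i k. i < n \<Longrightarrow> p (2 * i) \<le> k \<Longrightarrow> k < p (2 * i + 1) \<Longrightarrow> 1 \<le> (- 1) ^ i * g k x) \<Longrightarrow>
    x \<in> alternating g n p"
  unfolding alternating_def by blast

lemma alternatingD:
  fixes g :: "nat \<Rightarrow> 'a::real_normed_vector \<Rightarrow>\<^sub>L real"
  shows "x \<in> alternating g n p \<Longrightarrow> i < n \<Longrightarrow> p (2 * i) \<le> k \<Longrightarrow> k < p (2 * i + 1) \<Longrightarrow> 1 \<le> (- 1) ^ i * g k x"
  unfolding alternating_def by blast

text \<open>The two sequences are interleaved as \<open>p\<^sub>0 < q\<^sub>0 < p\<^sub>1 < p\<^sub>2 < q\<^sub>1 < q\<^sub>2 < p\<^sub>3 < \<dots>\<close> (the truncated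
  \<open>2 * 0 - 1\<close> is intended). The \<open>i\<close>-th blocks of \<open>x\<close> and \<open>y\<close> overlap, and so do the \<open>(i + 1)\<close>-st block of
  \<open>x\<close> and the \<open>i\<close>-th block of \<open>y\<close>, where the signs are opposite.\<close>

lemma alternating_interleave:
  fixes g :: "nat \<Rightarrow> 'a::real_normed_vector \<Rightarrow>\<^sub>L real"
  assumes h: "strict_mono h"
    and x: "x \<in> alternating g (Suc n) (h \<circ> (\<lambda>m. if even m then 2 * m - 1 else 2 * m))"
    and y: "y \<in> alternating g (Suc n) (h \<circ> (\<lambda>m. if even m then 2 * m + 1 else 2 * m + 2))"
  shows "(x + y) /\<^sub>R 2 \<in> alternating g (Suc n) (h \<circ> (\<lambda>m. if even m then 2 * m + 1 else 2 * m))"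
    and "(y - x) /\<^sub>R 2 \<in> alternating g n (h \<circ> (\<lambda>m. if even m then 2 * m + 3 else 2 * m + 2))"
proof -
  define P Q S R :: "nat \<Rightarrow> nat" where
    "P = (\<lambda>m. if even m then 2 * m - 1 else 2 * m)" and "Q = (\<lambda>m. if even m then 2 * m + 1 else 2 * m + 2)" and
    "S = (\<lambda>m. if even m then 2 * m + 1 else 2 * m)" and "R = (\<lambda>m. if even m then 2 * m + 3 else 2 * m + 2)"
  have vals: "P (2 * i) = 4 * i - 1" "P (2 * i + 1) = 4 * i + 2" "Q (2 * i) = 4 * i + 1" "Q (2 * i + 1) = 4 * i + 4"
    "S (2 * i) = 4 * i + 1" "S (2 * i + 1) = 4 * i + 2" "R (2 * i) = 4 * i + 3" "R (2 * i + 1) = 4 * i + 4" for i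
    by (auto simp: P_def Q_def S_def R_def)
  have mono: "h i \<le> h j" if "i \<le> j" for i j using h that by (simp add: strict_mono_less_eq)
  have x': "1 \<le> (- 1) ^ i * g k x" if "i \<le> n" "h (4 * i - 1) \<le> k" "k < h (4 * i + 2)" for i k
    using alternatingD[OF x[folded P_def], of i k] that by (simp only: comp_apply vals less_Suc_eq_le)
  have y': "1 \<le> (- 1) ^ i * g k y" if "i \<le> n" "h (4 * i + 1) \<le> k" "k < h (4 * i + 4)" for i k
    using alternatingD[OF y[folded Q_def], of i k] that by (simp only: comp_apply vals less_Suc_eq_le)
  have "(x + y) /\<^sub>R 2 \<in> alternating g (Suc n) (h \<circ> S)"
  proof (rule alternatingI)
    fix i k assume i: "i < Suc n" and "(h \<circ> S) (2 * i) \<le> k" "k < (h \<circ> S) (2 * i + 1)"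
    hence k: "h (4 * i + 1) \<le> k" "k < h (4 * i + 2)" by (simp_all only: comp_apply vals)
    have "1 \<le> (- 1) ^ i * g k x" using i k order_trans[OF mono k(1), of "4 * i - 1"] by (intro x') auto
    moreover have "1 \<le> (- 1) ^ i * g k y"
      using i k less_le_trans[OF k(2) mono, of "4 * i + 4"] by (intro y') auto
    ultimately show "1 \<le> (- 1) ^ i * g k ((x + y) /\<^sub>R 2)"
      by (simp add: blinfun.scaleR_right blinfun.add_right distrib_left)
  qed
  thus "(x + y) /\<^sub>R 2 \<in> alternating g (Suc n) (h \<circ> (\<lambda>m. if even m then 2 * m + 1 else 2 * m))"
    by (simp only: S_def)
  have "(y - x) /\<^sub>R 2 \<in> alternating g n (h \<circ> R)"
  proof (rule alternatingI)
    fix i k assume i: "i < n" and "(h \<circ> R) (2 * i) \<le> k" "k < (h \<circ> R) (2 * i + 1)"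
    hence k: "h (4 * i + 3) \<le> k" "k < h (4 * i + 4)" by (simp_all only: comp_apply vals)
    have eq: "4 * Suc i - 1 = 4 * i + 3" "4 * Suc i + 2 = 4 * i + 6" by simp_all
    have "1 \<le> (- 1) ^ Suc i * g k x"
      using i k less_le_trans[OF k(2) mono, of "4 * i + 6"] by (intro x') (simp_all only: eq)
    moreover have "1 \<le> (- 1) ^ i * g k y"
      using i k order_trans[OF mono k(1), of "4 * i + 1"] by (intro y') auto
    ultimately show "1 \<le> (- 1) ^ i * g k ((y - x) /\<^sub>R 2)"
      by (simp add: blinfun.scaleR_right blinfun.diff_right right_diff_distrib)
  qed
  thus "(y - x) /\<^sub>R 2 \<in> alternating g n (h \<circ> (\<lambda>m. if even m then 2 * m + 3 else 2 * m + 2))"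
    by (simp only: R_def)
qed

text \<open>Take interleaved \<open>x\<close> and \<open>y\<close> of norm about
  \<open>c (Suc n)\<close>. Their mean alternates along \<open>Suc n\<close> blocks, so
  \<open>norm (x + y)\<close> is at least \<open>2 * c (Suc n)\<close>; non-squareness then makes
  \<open>norm (y - x)\<close> small. As half of \<open>y - x\<close> alternates along
  \<open>n\<close> blocks, \<open>c n \<le> z * c (Suc n)\<close> with \<open>z < 1\<close>, against
  the linear bound.\<close>

lemma uniformly_nonsquare_alternating_unbounded:
  fixes g :: "nat \<Rightarrow> 'a::real_normed_vector \<Rightarrow>\<^sub>L real"
  assumes uns: "uniformly_nonsquare TYPE('a)" and g: "\<And>k. norm (g k) \<le> 1"
    and ex: "\<And>n p. strict_mono p \<Longrightarrow> \<exists>z\<in>alternating g n p. norm z \<le> C * real n"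
  shows False
proof -
  obtain \<delta> where \<delta>: "0 < \<delta>" "\<delta> \<le> 1" and sq: "\<And>r x y::'a. norm x \<le> r \<Longrightarrow> norm y \<le> r \<Longrightarrow>
     norm (x + y) \<le> (2 - \<delta>) * r \<or> norm (x - y) \<le> (2 - \<delta>) * r"
    using uniformly_nonsquare_scaled[OF uns] by blast
  \<comment> \<open>With \<open>c (Suc n) \<ge> 1 / 2\<close>, the radius
    \<open>r = c (Suc n) + \<delta> / 8\<close> satisfies
    \<open>(2 - \<delta>) * r \<le> 2 * z * c (Suc n)\<close>.\<close>
  define z where "z = 1 - \<delta> / 4"
  have z: "0 < z" "z < 1" using \<delta> by (auto simp: z_def)
  have "(\<lambda>n. C * (real n * z ^ n + z ^ n)) \<longlonglongrightarrow> C * (0 + 0)"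
    using powser_times_n_limit_0[of z] z by (intro tendsto_intros LIMSEQ_realpow_zero) auto
  hence "eventually (\<lambda>n. C * (real n * z ^ n + z ^ n) < 1 / 2) sequentially"
    by (rule order_tendstoD) simp
  \<comment> \<open>The value \<open>1 / 2\<close> is the lower bound that \<open>c 1\<close> will
    have.\<close>
  then obtain N where N: "C * (real N * z ^ N + z ^ N) < 1 / 2" by (auto simp: eventually_sequentially)
  have ne: "alternating g n p \<noteq> {}" if "strict_mono p" for n p using ex[OF that] by blast
  obtain h :: "nat \<Rightarrow> nat" and c :: "nat \<Rightarrow> real" where h: "strict_mono h" and c:
    "\<And>n a. n < N + 2 \<Longrightarrow> strict_mono a \<Longrightarrow>
       c n \<le> alternating_norm g n (h \<circ> a) \<and> alternating_norm g n (h \<circ> a) < c n + \<delta> / 8"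
    using alternating_norm_stable[of "\<delta> / 8" g C "N + 2"] \<delta>(1) ex by auto
  have id: "strict_mono (id :: nat \<Rightarrow> nat)" by (rule strict_mono_id)
  have c_ge: "1 / 2 \<le> c n" if "0 < n" "n < N + 2" for n
    using alternating_norm_ge_1[OF g h that(1) ne[OF h]] c[OF that(2) id] \<delta>(2) by simp
  have step: "c n \<le> z * c (Suc n)" if n: "n \<le> N" for n
  proof -
    let ?P = "\<lambda>m::nat. if even m then 2 * m - 1 else 2 * m"
    let ?Q = "\<lambda>m::nat. if even m then 2 * m + 1 else 2 * m + 2"
    let ?S = "\<lambda>m::nat. if even m then 2 * m + 1 else 2 * m"
    let ?R = "\<lambda>m::nat. if even m then 2 * m + 3 else 2 * m + 2"
    have m: "strict_mono ?P" "strict_mono ?Q" "strict_mono ?S" "strict_mono ?R"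
      by (auto simp: strict_mono_Suc_iff elim!: evenE oddE)
    define r where "r = c (Suc n) + \<delta> / 8"
    have n': "Suc n < N + 2" "n < N + 2" using n by auto
    have "alternating_norm g (Suc n) (h \<circ> ?P) < r" using c[OF n'(1) m(1)] unfolding r_def by blast
    from alternating_norm_less[OF this ne[OF strict_mono_o[OF h m(1)]]]
    obtain x where x: "x \<in> alternating g (Suc n) (h \<circ> ?P)" "norm x < r" by blast
    have "alternating_norm g (Suc n) (h \<circ> ?Q) < r" using c[OF n'(1) m(2)] unfolding r_def by blast
    from alternating_norm_less[OF this ne[OF strict_mono_o[OF h m(2)]]]
    obtain y where y: "y \<in> alternating g (Suc n) (h \<circ> ?Q)" "norm y < r" by blast
    have "c (Suc n) \<le> norm ((x + y) /\<^sub>R 2)"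
      using alternating_norm_le[OF alternating_interleave(1)[OF h x(1) y(1)]] c[OF n'(1) m(3)] by linarith
    hence 1: "2 * c (Suc n) \<le> norm (y + x)" by (simp add: add.commute)
    have "c n \<le> norm ((y - x) /\<^sub>R 2)"
      using alternating_norm_le[OF alternating_interleave(2)[OF h x(1) y(1)]] c[OF n'(2) m(4)] by linarith
    hence 2: "2 * c n \<le> norm (y - x)" by simp
    have c': "1 / 2 \<le> c (Suc n)" using c_ge n' by simp
    have \<delta>c: "\<delta> / 2 \<le> \<delta> * c (Suc n)" using mult_left_mono[OF c', of \<delta>] \<delta> by simp
    have r: "(2 - \<delta>) * r = 2 * c (Suc n) - \<delta> * c (Suc n) + \<delta> / 4 - \<delta> * \<delta> / 8"
      by (simp add: r_def field_simps)
    consider "norm (y + x) \<le> (2 - \<delta>) * r" | "norm (y - x) \<le> (2 - \<delta>) * r"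
      using sq[of y r x] x(2) y(2) by auto
    thus ?thesis
    proof cases
      \<comment> \<open>This case is impossible:
        \<open>\<delta> * c (Suc n) \<ge> \<delta> / 2\<close> makes the right-hand side smaller
        than \<open>2 * c (Suc n)\<close>.\<close>
      case 1
      hence "2 * c (Suc n) \<le> 2 * c (Suc n) - \<delta> * c (Suc n) + \<delta> / 4 - \<delta> * \<delta> / 8"
        using \<open>2 * c (Suc n) \<le> norm (y + x)\<close> r by linarith
      moreover have "0 \<le> \<delta> * \<delta>" by simp
      ultimately show ?thesis using \<delta>c \<delta> by linarith
    next
      case 2
      hence "2 * c n \<le> 2 * c (Suc n) - \<delta> * c (Suc n) + \<delta> / 4 - \<delta> * \<delta> / 8"
        using \<open>2 * c n \<le> norm (y - x)\<close> r by linarith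
      moreover have "0 \<le> \<delta> * \<delta>" by simp
      ultimately have "2 * c n \<le> 2 * c (Suc n) - \<delta> * c (Suc n) / 2" using \<delta>c by linarith
      thus ?thesis by (simp add: z_def algebra_simps)
    qed
  qed
  have grow: "c 1 \<le> z ^ n * c (Suc n)" if "n \<le> N" for n
    using that
  proof (induction n)
    case (Suc n)
    have "c 1 \<le> z ^ n * c (Suc n)" using Suc by simp
    also have "\<dots> \<le> z ^ n * (z * c (Suc (Suc n)))" using step[of "Suc n"] Suc.prems z by (intro mult_left_mono) auto
    finally show ?case by (simp add: mult_ac)
  qed simp
  obtain v where v: "v \<in> alternating g (Suc N) (h \<circ> id)" "norm v \<le> C * real (Suc N)" 
    using ex[OF strict_mono_o[OF h id], of "Suc N"] by blast
  have "c (Suc N) \<le> C * real (Suc N)"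
    using alternating_norm_le[OF v(1)] v(2) c[OF _ id, of "Suc N"] by simp
  hence "z ^ N * c (Suc N) \<le> z ^ N * (C * real (Suc N))" using z by (intro mult_left_mono) auto
  also have "\<dots> = C * (real N * z ^ N + z ^ N)" by (simp add: algebra_simps)
  finally show False using N grow[of N] c_ge[of 1] by simp
qed

theorem uniformly_nonsquare_imp_reflexive:
  assumes "uniformly_nonsquare TYPE('a::banach)"
  shows "reflexive_space TYPE('a)"
proof (rule ccontr)
  assume "\<not> reflexive_space TYPE('a)"
  thus False
  proof (rule nonreflexive_ladder)
    fix M \<theta> :: real and x :: "nat \<Rightarrow> 'a" and g :: "nat \<Rightarrow> 'a \<Rightarrow>\<^sub>L real"
    assume g: "\<And>n. norm (g n) \<le> 1"
      and l: "0 < \<theta>" "\<And>n. norm (x n) \<le> M" "\<And>i n. i < n \<Longrightarrow> g i (x n) = \<theta>" "\<And>i n. n \<le> i \<Longrightarrow> g i (x n) = 0"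
    show False
      by (rule uniformly_nonsquare_alternating_unbounded[OF assms g ladder_alternating[OF l]])
  qed
qed

section \<open>Inheritance under finite representability\<close>

text \<open>Passing to \<open>'a\<close> by \<open>T\<close> and back costs the factor
  \<open>c\<close> twice on the span of \<open>x\<close> and \<open>y\<close>; with
  \<open>c = 1 + \<delta> / 8\<close> the constant remains at most
  \<open>2 - \<delta> / 4\<close>.\<close>

lemma uniformly_nonsquare_finitely_representable:
  assumes uns: "uniformly_nonsquare TYPE('a::real_normed_vector)"
    and fr: "finitely_representable TYPE('b::real_normed_vector) TYPE('a)"
  shows "uniformly_nonsquare TYPE('b)"
proof -
  obtain \<delta> where \<delta>: "0 < \<delta>" "\<delta> \<le> 1" and sq: "\<And>r x y::'a. norm x \<le> r \<Longrightarrow> norm y \<le> r \<Longrightarrow>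
     norm (x + y) \<le> (2 - \<delta>) * r \<or> norm (x - y) \<le> (2 - \<delta>) * r"
    using uniformly_nonsquare_scaled[OF uns] by blast
  define c where "c = 1 + \<delta> / 8"
  have c: "1 < c" using \<delta> by (simp add: c_def)
  have "\<delta> * \<delta> \<le> \<delta> * 1" "0 \<le> \<delta> * \<delta> * \<delta>" using \<delta> by (auto intro: mult_left_mono)
  hence bound: "c * ((2 - \<delta>) * c) \<le> 2 - \<delta> / 4" using \<delta>
    by (simp add: c_def algebra_simps)
  have "norm (x + y) \<le> 2 - \<delta> / 4 \<or> norm (x - y) \<le> 2 - \<delta> / 4" if xy: "norm x \<le> 1" "norm y \<le> 1" for x y :: 'b
  proof -
    obtain T :: "'b \<Rightarrow> 'a" where T: "linear T" "\<And>v. v \<in> span {x, y} \<Longrightarrow> norm v / c \<le> norm (T v) \<and> norm (T v) \<le> c * norm v"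
      using fr[unfolded finitely_representable_def, rule_format, of "{x, y}" c] c by auto
    have sp: "x \<in> span {x, y}" "y \<in> span {x, y}" by (auto intro: span_base)
    have up: "norm v \<le> c * norm (T v)" if "v \<in> span {x, y}" for v
      using T(2)[OF that] c by (simp add: field_simps)
    have "norm (T v) \<le> c" if "v \<in> span {x, y}" "norm v \<le> 1" for v
    proof -
      have "c * norm v \<le> c * 1" using that(2) c by (intro mult_left_mono) auto
      thus ?thesis using T(2)[OF that(1)] by linarith
    qed
    hence "norm (T x) \<le> c" "norm (T y) \<le> c" using sp xy by auto
    from sq[OF this] show ?thesis
    proof
      assume "norm (T x + T y) \<le> (2 - \<delta>) * c"
      hence "c * norm (T (x + y)) \<le> c * ((2 - \<delta>) * c)" using c T(1) by (simp add: linear_add)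
      thus ?thesis using up[OF span_add[OF sp]] bound by linarith
    next
      assume "norm (T x - T y) \<le> (2 - \<delta>) * c"
      hence "c * norm (T (x - y)) \<le> c * ((2 - \<delta>) * c)" using c T(1) by (simp add: linear_diff)
      thus ?thesis using up[OF span_diff[OF sp]] bound by linarith
    qed
  qed
  thus ?thesis using \<delta> unfolding uniformly_nonsquare_def by (intro exI[of _ "\<delta> / 4"]) auto
qed

section \<open>Weak compactness in reflexive spaces\<close>

definition weakly_tendsto :: "('i \<Rightarrow> 'a::real_normed_vector) \<Rightarrow> 'a \<Rightarrow> 'i filter \<Rightarrow> bool" where
  "weakly_tendsto w z F \<longleftrightarrow> (\<forall>f::'a \<Rightarrow>\<^sub>L real. ((\<lambda>i. f (w i)) \<longlongrightarrow> f z) F)"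

lemma weakly_tendsto_mono: "weakly_tendsto w z F \<Longrightarrow> F' \<le> F \<Longrightarrow> weakly_tendsto w z F'"
  unfolding weakly_tendsto_def using tendsto_mono by blast

lemma weakly_tendsto_const: "weakly_tendsto (\<lambda>_. a) a F"
  by (simp add: weakly_tendsto_def)

lemma weakly_tendsto_diff:
  "weakly_tendsto w z F \<Longrightarrow> weakly_tendsto v y F \<Longrightarrow> weakly_tendsto (\<lambda>i. w i - v i) (z - y) F"
  unfolding weakly_tendsto_def by (auto simp: blinfun.diff_right intro!: tendsto_diff)

text \<open>Otherwise a functional separates \<open>z\<close> from \<open>C\<close> with a positive
  gap, which persists in the limit.\<close>

lemma weakly_tendsto_closed_convex:
  assumes w: "weakly_tendsto w z F" and F: "F \<noteq> bot" and C: "closed C" "convex C"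
    and ev: "eventually (\<lambda>i. w i \<in> C) F"
  shows "z \<in> C"
proof (rule ccontr)
  assume z: "z \<notin> C"
  have ne: "C \<noteq> {}" using eventually_happens[OF ev] F by auto
  define d where "d = infdist z C"
  have d: "0 < d" using infdist_pos_not_in_closed[OF C(1) ne z] by (simp add: d_def)
  obtain f :: "'b \<Rightarrow>\<^sub>L real" where f: "\<And>c. c \<in> C \<Longrightarrow> f c + d \<le> f z"
    using convex_separation[OF C(2) ne, of d z] infdist_le[of _ C z] by (metis d_def dist_norm)
  have "f z \<le> f z - d"
  proof (rule tendsto_upperbound)
    show "((\<lambda>i. f (w i)) \<longlongrightarrow> f z) F" using w by (simp add: weakly_tendsto_def)
    show "eventually (\<lambda>i. f (w i) \<le> f z - d) F" using ev by (rule eventually_mono) (use f in fastforce)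
  qed (rule F)
  thus False using d by simp
qed

text \<open>Weak lower semicontinuity of the norm, read off from a functional that norms
  \<open>z\<close>.\<close>

lemma weakly_tendsto_norm_greater:
  assumes w: "weakly_tendsto w z F" and s: "s < norm z"
  shows "eventually (\<lambda>i. s < norm (w i)) F"
proof -
  obtain f :: "'b \<Rightarrow>\<^sub>L real" where f: "norm f \<le> 1" "f z = norm z" by (rule norming_functional)
  have "((\<lambda>i. f (w i)) \<longlongrightarrow> norm z) F" using w f(2) by (metis weakly_tendsto_def)
  hence "eventually (\<lambda>i. s < f (w i)) F" using s by (rule order_tendstoD)
  moreover have "f v \<le> norm v" for v
  proof -
    have "f v \<le> norm f * norm v" using norm_blinfun[of f v] by simp
    also have "\<dots> \<le> 1 * norm v" using f(1) by (intro mult_right_mono) auto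
    finally show ?thesis by simp
  qed
  ultimately show ?thesis by (auto elim!: eventually_mono intro: less_le_trans)
qed

text \<open>Subfilters replace subsequences, so that no form of the Eberlein-Smulian theorem is needed.\<close>

lemma reflexive_weak_cluster:
  fixes w :: "'i \<Rightarrow> 'a::banach"
  assumes refl: "reflexive_space TYPE('a)" and F: "F \<noteq> bot" and M: "\<And>i. norm (w i) \<le> M"
  shows "\<exists>F' z. F' \<le> F \<and> F' \<noteq> bot \<and> weakly_tendsto w z F'"
proof -
  define E :: "'i \<Rightarrow> ('a \<Rightarrow>\<^sub>L real) \<Rightarrow> real" where "E i f = f (w i)" for i f
  \<comment> \<open>As in the Banach-Alaoglu theorem, evaluation at \<open>w i\<close> is a point of
    a product of compact intervals.\<close>
  define S where "S = PiE UNIV (\<lambda>f::'a \<Rightarrow>\<^sub>L real. {- M * norm f..M * norm f})"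
  have "compactin (product_topology (\<lambda>_. euclidean) UNIV) S"
    unfolding S_def by (auto simp: compactin_PiE)
  hence S: "compact S" by (simp add: euclidean_product_topology)
  have ES: "E i \<in> S" for i
  proof -
    have "\<bar>f (w i)\<bar> \<le> M * norm f" for f :: "'a \<Rightarrow>\<^sub>L real"
      using norm_blinfun[of f "w i"] mult_left_mono[OF M[of i] norm_ge_zero[of f]] by (simp add: mult.commute)
    thus ?thesis by (auto simp: S_def E_def abs_le_iff minus_le_iff)
  qed
  have "filtermap E F \<noteq> bot" using F by (simp add: filtermap_bot_iff)
  moreover have "eventually (\<lambda>x. x \<in> S) (filtermap E F)" using ES by (simp add: eventually_filtermap)
  ultimately obtain l where l: "inf (nhds l) (filtermap E F) \<noteq> bot"
    using S unfolding compact_filter by blast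
  \<comment> \<open>\<open>F\<close> is refined by the preimages of the neighbourhoods of the
    cluster point \<open>l\<close>, so that the evaluations converge to \<open>l\<close>.\<close>
  define F' where "F' = inf F (filtercomap E (nhds l))"
  have F': "F' \<noteq> bot"
  proof
    assume "F' = bot"
    then obtain P Q where P: "eventually P F" and Q: "eventually Q (nhds l)" and PQ: "\<And>i. P i \<Longrightarrow> \<not> Q (E i)"
      unfolding F'_def trivial_limit_def eventually_inf eventually_filtercomap by blast
    have "eventually (\<lambda>x. \<not> Q x) (filtermap E F)"
      unfolding eventually_filtermap using P by (rule eventually_mono) (rule PQ)
    with Q have "eventually (\<lambda>_. False) (inf (nhds l) (filtermap E F))"
      unfolding eventually_inf by blast
    thus False using l by (simp add: trivial_limit_def)
  qed
  have lim: "((\<lambda>i. f (w i)) \<longlongrightarrow> l f) F'" for f :: "'a \<Rightarrow>\<^sub>L real"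
  proof -
    have "(E \<longlongrightarrow> l) F'" unfolding F'_def filterlim_def
      by (metis filtermap_filtercomap filtermap_mono inf_le2 order_trans)
    hence "((\<lambda>i. (\<lambda>x. x f) (E i)) \<longlongrightarrow> l f) F'"
      by (rule continuous_on_tendsto_compose[OF continuous_on_product_coordinates]) auto
    thus ?thesis by (simp add: E_def)
  qed
  \<comment> \<open>The limit is thus an element of the bidual, which reflexivity represents by some
    \<open>z\<close>.\<close>
  have "bounded_linear l"
  proof (rule bounded_linear_intro[where K = M])
    fix f g :: "'a \<Rightarrow>\<^sub>L real" and r :: real
    show "l (f + g) = l f + l g"
      using lim[of "f + g"] tendsto_add[OF lim[of f] lim[of g]] F'
      by (intro tendsto_unique[OF F']) (auto simp: blinfun.add_left)
    show "l (r *\<^sub>R f) = r *\<^sub>R l f"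
      using lim[of "r *\<^sub>R f"] tendsto_mult_left[OF lim[of f], of r] F'
      by (intro tendsto_unique[OF F']) (auto simp: blinfun.scaleR_left)
    have "norm (f (w i)) \<le> norm f * M" for i
      using norm_blinfun[of f "w i"] mult_left_mono[OF M[of i] norm_ge_zero[of f]] by linarith
    thus "norm (l f) \<le> norm f * M"
      by (intro tendsto_upperbound[OF tendsto_norm[OF lim[of f]] _ F']) auto
  qed
  hence "blinfun_apply (Blinfun l) = l" by (rule bounded_linear_Blinfun_apply)
  moreover obtain z where "canonical_embedding z = Blinfun l"
    using refl by (metis reflexive_space_def surj_def)
  ultimately have "l f = f z" for f using canonical_embedding_apply[of z f] by simp
  hence "weakly_tendsto w z F'" using lim by (simp add: weakly_tendsto_def)
  thus ?thesis using F' unfolding F'_def by (intro exI conjI) auto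
qed

text \<open>Choose a point in every member. A weak cluster point along the filter of ever smaller
  members lies in each of them, since closed convex sets are weakly closed.\<close>

lemma reflexive_chain_Inter_nonempty:
  fixes \<C> :: "'a::banach set set"
  assumes refl: "reflexive_space TYPE('a)" and ne: "\<C> \<noteq> {}"
    and chain: "\<And>C D. C \<in> \<C> \<Longrightarrow> D \<in> \<C> \<Longrightarrow> C \<subseteq> D \<or> D \<subseteq> C"
    and C: "\<And>C. C \<in> \<C> \<Longrightarrow> closed C \<and> convex C \<and> C \<noteq> {} \<and> C \<subseteq> cball 0 M"
  shows "\<Inter>\<C> \<noteq> {}"
proof -
  define w where "w C = (if C \<in> \<C> then SOME x. x \<in> C else 0)" for C
  have w: "w C \<in> C" if "C \<in> \<C>" for C using C[OF that] that by (auto simp: w_def some_in_eq)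
  have M: "norm (w C) \<le> max M 0" for C
    using w[of C] C[of C] by (cases "C \<in> \<C>") (auto simp: w_def)
  define G where "G C = principal {D\<in>\<C>. D \<subseteq> C}" for C
  define F where "F = (INF C\<in>\<C>. G C)"
  have ev: "eventually P F \<longleftrightarrow> (\<exists>C\<in>\<C>. eventually P (G C))" for P
    unfolding F_def
  proof (rule eventually_INF_base[OF ne])
    fix C D assume "C \<in> \<C>" "D \<in> \<C>"
    then consider "C \<in> \<C>" "C \<subseteq> D" | "D \<in> \<C>" "D \<subseteq> C" using chain by blast
    thus "\<exists>B\<in>\<C>. G B \<le> inf (G C) (G D)"
      by cases (force simp: G_def intro!: bexI[of _ C], force simp: G_def intro!: bexI[of _ D])
  qed
  have "F \<noteq> bot" unfolding trivial_limit_def ev by (auto simp: G_def eventually_principal)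
  then obtain F' z where F': "F' \<le> F" "F' \<noteq> bot" "weakly_tendsto w z F'"
    using reflexive_weak_cluster[OF refl, of F w] M by blast
  have "z \<in> C" if c: "C \<in> \<C>" for C
  proof (rule weakly_tendsto_closed_convex[OF F'(3,2)])
    have "eventually (\<lambda>D. w D \<in> C) F"
      unfolding ev using c w by (auto intro!: bexI[of _ C] simp: G_def eventually_principal)
    thus "eventually (\<lambda>D. w D \<in> C) F'" using F'(1) by (rule filter_leD[rotated])
  qed (use C c in auto)
  thus ?thesis by blast
qed

section \<open>The fixed point property\<close>

locale minimal_invariant_set =
  fixes K :: "'a::banach set" and T :: "'a \<Rightarrow> 'a"
  assumes refl: "reflexive_space TYPE('a)"
    and K: "K \<noteq> {}" "closed K" "bounded K" "convex K"
    and maps: "x \<in> K \<Longrightarrow> T x \<in> K"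
    and nonexp: "x \<in> K \<Longrightarrow> y \<in> K \<Longrightarrow> norm (T x - T y) \<le> norm (x - y)"
    and minimal: "L \<subseteq> K \<Longrightarrow> L \<noteq> {} \<Longrightarrow> closed L \<Longrightarrow> convex L \<Longrightarrow> T ` L \<subseteq> L \<Longrightarrow> L = K"
begin

lemma norm_le_diameter: "x \<in> K \<Longrightarrow> y \<in> K \<Longrightarrow> norm (x - y) \<le> diameter K"
  using diameter_bounded_bound[OF K(3)] by (simp add: dist_norm)

text \<open>The hull lies in \<open>K\<close>, so \<open>T\<close> maps it into the image of
  \<open>K\<close>, which the hull contains; minimality applies.\<close>

lemma closure_convex_hull_image: "closure (convex hull (T ` K)) = K"
proof (rule minimal)
  have "convex hull (T ` K) \<subseteq> K" using maps K(4) by (intro hull_minimal) auto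
  thus sub: "closure (convex hull (T ` K)) \<subseteq> K" using K(2) by (rule closure_minimal)
  show "T ` closure (convex hull (T ` K)) \<subseteq> closure (convex hull (T ` K))"
    using sub hull_subset[of "T ` K" convex] closure_subset[of "convex hull (T ` K)"] by blast
  show "closure (convex hull (T ` K)) \<noteq> {}" using K(1) by (simp add: closure_eq_empty)
qed (auto intro: convex_closure)

text \<open>Suppose \<open>K\<close> lies in the \<open>r\<close>-ball about \<open>z\<close>, and
  let \<open>C\<close> be the set of all such centres in \<open>K\<close>. If \<open>u\<close> is a
  centre, the \<open>r\<close>-ball about \<open>T u\<close> contains the image of \<open>K\<close>,
  hence its closed convex hull \<open>K\<close>. So \<open>C\<close> is invariant, every point of
  \<open>K\<close> is a centre, and the diameter is at most \<open>r\<close>.\<close>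

lemma diametral:
  assumes z: "z \<in> K" and r: "r < diameter K"
  shows "\<exists>x\<in>K. r < norm (z - x)"
proof (rule ccontr)
  assume "\<not> ?thesis"
  hence zr: "norm (z - x) \<le> r" if "x \<in> K" for x using that by force
  define C where "C = K \<inter> (\<Inter>x\<in>K. cball x r)"
  have "C = K"
  proof (rule minimal)
    show "C \<noteq> {}" using z zr by (auto simp: C_def dist_norm norm_minus_commute)
    show "closed C" using K(2) by (auto simp: C_def)
    show "convex C" unfolding C_def using K(4) by (intro convex_Int convex_INT) auto
    show "T ` C \<subseteq> C"
    proof (clarify)
      fix u assume u: "u \<in> C"
      have "T ` K \<subseteq> cball (T u) r"
      proof clarify
        fix x assume x: "x \<in> K"
        have "norm (T u - T x) \<le> norm (u - x)" using u x by (intro nonexp) (auto simp: C_def)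
        also have "\<dots> \<le> r" using u x by (auto simp: C_def dist_norm norm_minus_commute)
        finally show "T x \<in> cball (T u) r" by (simp add: dist_norm)
      qed
      hence "closure (convex hull (T ` K)) \<subseteq> cball (T u) r"
        by (intro closure_minimal hull_minimal) auto
      thus "T u \<in> C" using u maps unfolding closure_convex_hull_image
        by (auto simp: C_def dist_commute)
    qed
  qed (auto simp: C_def)
  hence "x \<in> cball y r" if "x \<in> K" "y \<in> K" for x y using that unfolding C_def by blast
  hence "norm (x - y) \<le> r" if "x \<in> K" "y \<in> K" for x y
    using that by (simp add: dist_norm norm_minus_commute)
  hence "diameter K \<le> r" using K(1) by (intro diameter_le) auto
  thus False using r by simp
qed

text \<open>Otherwise an approximate fixed point sequence \<open>v\<close> stays within
  \<open>r\<close> of \<open>y\<close>. The \<open>x\<close> in \<open>K\<close> for which the limes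
  superior of \<open>norm (v n - x)\<close> is at most \<open>r\<close> form a closed convex
  invariant set, hence all of \<open>K\<close>. A weak cluster point of \<open>v\<close> is then
  within \<open>r\<close> of every point of \<open>K\<close>, against
  \<open>diametral\<close>.\<close>

lemma goebel_karlovitz:
  assumes y: "y \<in> K" and r: "r < diameter K"
  shows "\<exists>\<delta>>0. \<forall>v\<in>K. norm (T v - v) < \<delta> \<longrightarrow> r < norm (v - y)"
proof (rule ccontr)
  assume "\<not> ?thesis"
  hence "\<forall>n. \<exists>v\<in>K. norm (T v - v) < inverse (real (Suc n)) \<and> norm (v - y) \<le> r"
    by (meson inverse_positive_iff_positive not_less of_nat_0_less_iff zero_less_Suc)
  then obtain v where v: "\<And>n. v n \<in> K" "\<And>n. norm (T (v n) - v n) < inverse (real (Suc n))"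
    "\<And>n. norm (v n - y) \<le> r" by metis
  have lim0: "(\<lambda>n. norm (T (v n) - v n)) \<longlonglongrightarrow> 0"
    by (rule tendsto_sandwich[OF _ _ tendsto_const LIMSEQ_inverse_real_of_nat])
       (use v(2) in \<open>auto intro!: always_eventually less_imp_le\<close>)
  define C where "C = {x\<in>K. \<forall>\<eta>>0. eventually (\<lambda>n. norm (v n - x) \<le> r + \<eta>) sequentially}"
  have "C = K"
  proof (rule minimal)
    show "C \<noteq> {}"
    proof -
      have "norm (v n - y) \<le> r + \<eta>" if "\<eta> > 0" for n \<eta> using v(3)[of n] that by linarith
      thus ?thesis using y by (auto simp: C_def)
    qed
    show "closed C"
    proof (rule closed_sequential_limits[THEN iffD2], intro allI impI)
      fix u l assume "(\<forall>n. u n \<in> C) \<and> u \<longlonglongrightarrow> l"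
      hence u: "\<And>n. u n \<in> C" "u \<longlonglongrightarrow> l" by auto
      have "l \<in> K" using u K(2) by (auto simp: C_def intro: closed_sequentially)
      moreover have "eventually (\<lambda>n. norm (v n - l) \<le> r + \<eta>) sequentially" if \<eta>: "0 < \<eta>" for \<eta>
      proof -
        obtain m where m: "norm (u m - l) < \<eta> / 2"
          using u(2) \<eta> by (metis LIMSEQ_iff half_gt_zero order_refl)
        have "eventually (\<lambda>n. norm (v n - u m) \<le> r + \<eta> / 2) sequentially"
          using u(1)[of m] \<eta> by (auto simp: C_def)
        thus ?thesis
        proof (rule eventually_mono)
          fix n assume "norm (v n - u m) \<le> r + \<eta> / 2"
          thus "norm (v n - l) \<le> r + \<eta>"
            using norm_triangle_ineq[of "v n - u m" "u m - l"] m by simp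
        qed
      qed
      ultimately show "l \<in> C" by (simp add: C_def)
    qed
    show "convex C"
    proof (rule convexI)
      fix p q and a b :: real assume pq: "p \<in> C" "q \<in> C" and ab: "0 \<le> a" "0 \<le> b" "a + b = 1"
      have "eventually (\<lambda>n. norm (v n - (a *\<^sub>R p + b *\<^sub>R q)) \<le> r + \<eta>) sequentially" if \<eta>: "0 < \<eta>" for \<eta>
      proof -
        have "eventually (\<lambda>n. norm (v n - p) \<le> r + \<eta> \<and> norm (v n - q) \<le> r + \<eta>) sequentially"
          using pq \<eta> by (auto simp: C_def intro: eventually_conj)
        thus ?thesis
        proof (rule eventually_mono)
          fix n assume "norm (v n - p) \<le> r + \<eta> \<and> norm (v n - q) \<le> r + \<eta>"
          hence "p \<in> cball (v n) (r + \<eta>)" "q \<in> cball (v n) (r + \<eta>)" by (auto simp: dist_norm)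
          hence "a *\<^sub>R p + b *\<^sub>R q \<in> cball (v n) (r + \<eta>)" using ab by (intro convexD[OF convex_cball])
          thus "norm (v n - (a *\<^sub>R p + b *\<^sub>R q)) \<le> r + \<eta>" by (simp add: dist_norm)
        qed
      qed
      moreover have "a *\<^sub>R p + b *\<^sub>R q \<in> K" using pq ab by (intro convexD[OF K(4)]) (auto simp: C_def)
      ultimately show "a *\<^sub>R p + b *\<^sub>R q \<in> C" by (simp add: C_def)
    qed
    show "T ` C \<subseteq> C"
    proof clarify
      fix x assume x: "x \<in> C"
      have "eventually (\<lambda>n. norm (v n - T x) \<le> r + \<eta>) sequentially" if \<eta>: "0 < \<eta>" for \<eta>
      proof -
        have "eventually (\<lambda>n. norm (v n - x) \<le> r + \<eta> / 2) sequentially" using x \<eta> by (auto simp: C_def)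
        moreover have "eventually (\<lambda>n. norm (T (v n) - v n) < \<eta> / 2) sequentially"
          using lim0 \<eta> by (intro order_tendstoD) auto
        ultimately show ?thesis
        proof eventually_elim
          case (elim n)
          have "norm (T (v n) - T x) \<le> norm (v n - x)" using x v(1) by (intro nonexp) (auto simp: C_def)
          thus ?case using elim norm_triangle_ineq[of "v n - T (v n)" "T (v n) - T x"]
            by (simp add: norm_minus_commute)
        qed
      qed
      thus "T x \<in> C" using x maps by (simp add: C_def)
    qed
  qed (auto simp: C_def)
  obtain M where M: "\<And>x. x \<in> K \<Longrightarrow> norm x \<le> M" using K(3) by (auto simp: bounded_iff)
  obtain F' z where F': "F' \<le> sequentially" "F' \<noteq> bot" "weakly_tendsto v z F'"
    using reflexive_weak_cluster[OF refl sequentially_bot, of v M] M v(1) by blast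
  have "z \<in> K" using v(1) by (intro weakly_tendsto_closed_convex[OF F'(3,2) K(2,4)]) auto
  then obtain x where x: "x \<in> K" "r < norm (z - x)" using diametral r by blast
  define \<eta> where "\<eta> = (norm (z - x) - r) / 2"
  have \<eta>: "0 < \<eta>" using x by (simp add: \<eta>_def)
  have "eventually (\<lambda>n. norm (v n - x) \<le> r + \<eta>) sequentially" using x(1) \<open>C = K\<close> \<eta> by (auto simp: C_def)
  hence "eventually (\<lambda>n. v n \<in> cball x (r + \<eta>)) F'"
    using F'(1) by (intro filter_leD[of F' sequentially]) (auto simp: dist_norm norm_minus_commute)
  hence "z \<in> cball x (r + \<eta>)" by (intro weakly_tendsto_closed_convex[OF F'(3,2)]) auto
  thus False using x(2) by (simp add: dist_norm norm_minus_commute \<eta>_def field_simps)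
qed

section \<open>Resolvents and almost squares\<close>

lemma resolvent:
  assumes c: "c \<in> K" and l: "0 \<le> \<mu>" "\<mu> < 1"
  shows "\<exists>w\<in>K. w = (1 - \<mu>) *\<^sub>R c + \<mu> *\<^sub>R T w"
proof -
  have "\<exists>!w. w \<in> K \<and> (1 - \<mu>) *\<^sub>R c + \<mu> *\<^sub>R T w = w"
  proof (rule Banach_fix)
    show "complete K" using K(2) by (simp add: complete_eq_closed)
    show "(\<lambda>w. (1 - \<mu>) *\<^sub>R c + \<mu> *\<^sub>R T w) ` K \<subseteq> K"
    proof clarify
      fix w assume "w \<in> K"
      thus "(1 - \<mu>) *\<^sub>R c + \<mu> *\<^sub>R T w \<in> K" using c l by (intro convexD[OF K(4)] maps) auto
    qed
    show "dist ((1 - \<mu>) *\<^sub>R c + \<mu> *\<^sub>R T x) ((1 - \<mu>) *\<^sub>R c + \<mu> *\<^sub>R T y) \<le> \<mu> * dist x y"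
      if "x \<in> K" "y \<in> K" for x y
      using mult_left_mono[OF nonexp[OF that] l(1)] l
      by (simp add: dist_norm scaleR_diff_right[symmetric])
  qed (use K l in auto)
  thus ?thesis by metis
qed

lemma resolvent_displacement:
  assumes "c \<in> K" "w \<in> K" "0 \<le> \<mu>" "\<mu> < 1" "w = (1 - \<mu>) *\<^sub>R c + \<mu> *\<^sub>R T w"
  shows "norm (T w - w) \<le> (1 - \<mu>) * diameter K"
proof -
  have "T w - w = (1 - \<mu>) *\<^sub>R (T w - c)" by (subst (2) assms(5)) (simp add: algebra_simps)
  thus ?thesis using norm_le_diameter[OF maps[OF assms(2)] assms(1)] assms(4) by (simp add: mult_left_mono)
qed

theorem uniformly_nonsquare_diameter:
  assumes uns: "uniformly_nonsquare TYPE('a)"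
  shows "diameter K = 0"
proof (rule ccontr)
  define d where "d = diameter K"
  assume "\<not> ?thesis"
  hence d: "0 < d" using diameter_ge_0[OF K(3)] by (simp add: d_def)
  have dK: "norm (x - y) \<le> d" if "x \<in> K" "y \<in> K" for x y using norm_le_diameter that by (simp add: d_def)
  obtain M where M: "\<And>x. x \<in> K \<Longrightarrow> norm x \<le> M" using K(3) by (auto simp: bounded_iff)
  obtain \<delta> where \<delta>: "0 < \<delta>" and sq: "\<And>r (x::'a) y. norm x \<le> r \<Longrightarrow> norm y \<le> r \<Longrightarrow>
     norm (x + y) \<le> (2 - \<delta>) * r \<or> norm (x - y) \<le> (2 - \<delta>) * r"
    using uniformly_nonsquare_scaled[OF uns] by blast
  \<comment> \<open>With this value
    \<open>(2 - \<delta>) * (d / 2 + e) = d - 2 * e - \<delta> * e\<close>, below the norms of both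
    diagonals found at the end.\<close>
  define e where "e = \<delta> * d / 8"
  have e: "0 < e" using \<delta> d by (simp add: e_def)
  have "0 < \<delta> * e" using \<delta> e by simp
  hence gap: "(2 - \<delta>) * (d / 2 + e) < d - 2 * e" by (simp add: e_def field_simps)
  obtain k where k: "k \<in> K" using K(1) by blast
  have "\<exists>x\<in>K. norm (T x - x) \<le> inverse (real (Suc n)) * d" for n
  proof -
    define \<mu> where "\<mu> = 1 - inverse (real (Suc n))"
    have \<mu>: "0 \<le> \<mu>" "\<mu> < 1" by (auto simp: \<mu>_def field_simps)
    from resolvent[OF k this] resolvent_displacement[OF k _ this] show ?thesis
      by (fastforce simp: \<mu>_def d_def)
  qed
  then obtain x where x: "\<And>n. x n \<in> K" "\<And>n. norm (T (x n) - x n) \<le> inverse (real (Suc n)) * d" by metis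
  have xlim: "(\<lambda>n. norm (T (x n) - x n)) \<longlonglongrightarrow> 0"
  proof (rule tendsto_sandwich[OF _ _ tendsto_const])
    show "(\<lambda>n. inverse (real (Suc n)) * d) \<longlonglongrightarrow> 0"
      using tendsto_mult_right[OF LIMSEQ_inverse_real_of_nat, of d] by simp
  qed (use x(2) in \<open>auto intro!: always_eventually\<close>)
  obtain F p where F: "F \<le> sequentially" "F \<noteq> bot" and p: "weakly_tendsto x p F"
    using reflexive_weak_cluster[OF refl sequentially_bot, of x M] M x(1) by blast
  have pK: "p \<in> K" using x(1) by (intro weakly_tendsto_closed_convex[OF p F(2) K(2,4)]) auto
  obtain \<eta> where \<eta>: "0 < \<eta>" and far: "\<And>v. v \<in> K \<Longrightarrow> norm (T v - v) < \<eta> \<Longrightarrow> d - e < norm (v - p)"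
    using goebel_karlovitz[OF pK, of "d - e"] e by (auto simp: d_def)
  \<comment> \<open>So \<open>(1 - \<mu>) * d = \<eta> * \<mu> < \<eta>\<close>: \<open>T\<close>
    moves each \<open>w n\<close> by less than \<open>\<eta>\<close>, and \<open>far\<close>
    applies.\<close>
  define \<mu> where "\<mu> = d / (d + \<eta>)"
  have \<mu>: "0 < \<mu>" "\<mu> < 1" using d \<eta> by (auto simp: \<mu>_def)
  have \<mu>d: "(1 - \<mu>) * d < \<eta>"
  proof -
    have "(1 - \<mu>) * d = \<eta> * \<mu>" using d \<eta> by (simp add: \<mu>_def field_simps)
    thus ?thesis using \<mu> \<eta> by simp
  qed
  define c where "c n = (1 / 2) *\<^sub>R x n + (1 / 2) *\<^sub>R p" for n
  have c: "c n \<in> K" for n unfolding c_def using x(1) pK by (intro convexD[OF K(4)]) auto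
  have "\<forall>n. \<exists>w\<in>K. w = (1 - \<mu>) *\<^sub>R c n + \<mu> *\<^sub>R T w" using resolvent[OF c] \<mu> by simp
  then obtain w where w: "\<And>n. w n \<in> K" and w_eq: "\<And>n. w n = (1 - \<mu>) *\<^sub>R c n + \<mu> *\<^sub>R T (w n)" by metis
  have wp: "d - e < norm (w n - p)" for n
    using resolvent_displacement[OF c w _ \<mu>(2) w_eq, of n] \<mu>(1) \<mu>d by (intro far w) (simp add: d_def)
  \<comment> \<open>The resolvent is nonexpansive in its centre, and \<open>c n\<close>,
    \<open>c m\<close> are at most \<open>d / 2\<close> apart.\<close>
  have ww: "norm (w n - w m) \<le> d / 2" for n m
  proof -
    have eq: "w n - w m = (1 - \<mu>) *\<^sub>R ((1 / 2) *\<^sub>R (x n - x m)) + \<mu> *\<^sub>R (T (w n) - T (w m))"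
      by (subst (1) w_eq, subst (2) w_eq) (simp add: c_def algebra_simps)
    have "norm (w n - w m) \<le> norm ((1 - \<mu>) *\<^sub>R ((1 / 2) *\<^sub>R (x n - x m))) + norm (\<mu> *\<^sub>R (T (w n) - T (w m)))"
      unfolding eq by (rule norm_triangle_ineq)
    also have "\<dots> \<le> (1 - \<mu>) * (d / 2) + \<mu> * norm (w n - w m)"
      using dK[OF x(1) x(1), of n m] nonexp[OF w w, of n m] \<mu>
      by (intro add_mono) (auto intro!: mult_left_mono)
    finally have "(1 - \<mu>) * norm (w n - w m) \<le> (1 - \<mu>) * (d / 2)"
      unfolding left_diff_distrib mult_1 by linarith
    thus ?thesis using \<mu> by simp
  qed
  \<comment> \<open>Here \<open>x n\<close> is the resolvent of itself up to its displacement, which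
    is eventually below \<open>(1 - \<mu>) * e\<close>.\<close>
  have wx: "(1 - \<mu>) * norm (w n - x n) \<le> (1 - \<mu>) * (d / 2) + norm (T (x n) - x n)" for n
  proof -
    have eq: "w n - x n = (1 - \<mu>) *\<^sub>R ((1 / 2) *\<^sub>R (p - x n)) + \<mu> *\<^sub>R (T (w n) - T (x n)) + \<mu> *\<^sub>R (T (x n) - x n)"
      by (subst (1) w_eq) (simp add: c_def algebra_simps flip: scaleR_add_left)
    have "norm (w n - x n) \<le> norm ((1 - \<mu>) *\<^sub>R ((1 / 2) *\<^sub>R (p - x n)))
        + norm (\<mu> *\<^sub>R (T (w n) - T (x n))) + norm (\<mu> *\<^sub>R (T (x n) - x n))"
      by (subst eq) (intro order_trans[OF norm_triangle_ineq] add_mono order_refl norm_triangle_ineq)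
    also have "\<dots> \<le> (1 - \<mu>) * (d / 2) + \<mu> * norm (w n - x n) + norm (T (x n) - x n)"
      using dK[OF pK x(1), of n] nonexp[OF w x(1), of n n] \<mu>
      by (intro add_mono) (auto intro!: mult_left_mono mult_left_le_one_le)
    finally show ?thesis unfolding left_diff_distrib mult_1 by linarith
  qed
  have "eventually (\<lambda>n. norm (T (x n) - x n) < (1 - \<mu>) * e) sequentially"
    using xlim \<mu> e by (intro order_tendstoD) auto
  hence wx': "eventually (\<lambda>n. w n - x n \<in> cball 0 (d / 2 + e)) sequentially"
  proof (rule eventually_mono)
    fix n assume "norm (T (x n) - x n) < (1 - \<mu>) * e"
    hence "(1 - \<mu>) * norm (w n - x n) \<le> (1 - \<mu>) * (d / 2 + e)" using wx[of n] by (simp add: distrib_left)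
    thus "w n - x n \<in> cball 0 (d / 2 + e)" using \<mu> by simp
  qed
  obtain G z where G: "G \<le> F" "G \<noteq> bot" and z: "weakly_tendsto w z G"
    using reflexive_weak_cluster[OF refl F(2), of w M] M w by blast
  have zp: "norm (z - p) \<le> d / 2 + e"
  proof -
    have "eventually (\<lambda>n. w n - x n \<in> cball 0 (d / 2 + e)) G"
      using wx' order_trans[OF G(1) F(1)] by (rule filter_leD[rotated])
    hence "z - p \<in> cball 0 (d / 2 + e)"
      by (intro weakly_tendsto_closed_convex[OF weakly_tendsto_diff[OF z weakly_tendsto_mono[OF p G(1)]] G(2)]) auto
    thus ?thesis by simp
  qed
  \<comment> \<open>Mazur's lemma: some convex combination \<open>u\<close> of finitely many
    \<open>w i\<close> is close to \<open>z\<close> in norm.\<close>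
  have "z \<in> closure (convex hull (range w))"
    by (intro weakly_tendsto_closed_convex[OF z G(2)] always_eventually allI)
       (auto intro!: convex_closure closure_subset[THEN subsetD] hull_inc)
  then obtain u where u: "u \<in> convex hull (range w)" "norm (u - z) < e"
    using e unfolding closure_approachable by (auto simp: dist_norm)
  obtain V where V: "finite V" "V \<subseteq> range w" "u \<in> convex hull V"
    using u(1) unfolding convex_hull_explicit[of "range w"] by (auto simp: convex_hull_finite)
  \<comment> \<open>The weak limit in \<open>m\<close> is \<open>v - p\<close>, of norm above
    \<open>d - e\<close>; finiteness of \<open>V\<close> gives one \<open>m\<close> for all
    \<open>v\<close>.\<close>
  have "eventually (\<lambda>m. \<forall>v\<in>V. d - e < norm (z - p + v - w m)) G"
  proof (rule eventually_ball_finite[OF V(1)], rule ballI)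
    fix v assume "v \<in> V"
    hence "d - e < norm (z - p + v - z)" using V(2) wp by auto
    moreover have "weakly_tendsto (\<lambda>m. z - p + v - w m) (z - p + v - z) G"
      by (rule weakly_tendsto_diff[OF weakly_tendsto_const z])
    ultimately show "eventually (\<lambda>m. d - e < norm (z - p + v - w m)) G"
      by (rule weakly_tendsto_norm_greater[rotated])
  qed
  from eventually_happens[OF this] G(2)
  obtain m where m: "\<And>v. v \<in> V \<Longrightarrow> d - e < norm (z - p + v - w m)" by auto
  \<comment> \<open>If a ball of radius \<open>d - 2 * e\<close> contained all \<open>v\<close>, it
    would contain \<open>u\<close>; as \<open>u\<close> is within \<open>e\<close> of
    \<open>z\<close>, \<open>norm (w m - p)\<close> would be below \<open>d - e\<close>, against
    \<open>wp\<close>.\<close>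
  have "\<exists>v\<in>V. d - 2 * e < norm (w m + (z - p) - v)"
  proof (rule ccontr)
    assume "\<not> ?thesis"
    hence "V \<subseteq> cball (w m + (z - p)) (d - 2 * e)" by (auto simp: dist_norm not_less)
    hence "convex hull V \<subseteq> cball (w m + (z - p)) (d - 2 * e)" by (intro hull_minimal) auto
    hence "norm (w m + (z - p) - u) \<le> d - 2 * e" using V(3) by (auto simp: dist_norm)
    thus False using wp[of m] u(2) e norm_triangle_ineq[of "w m + (z - p) - u" "u - z"] by simp
  qed
  then obtain v where v: "v \<in> V" "d - 2 * e < norm (w m + (z - p) - v)" by blast
  obtain i where i: "v = w i" using v V(2) by auto
  have "norm (v - w m) \<le> d / 2 + e" using ww[of i m] e i by simp
  from sq[OF zp this] gap m[OF v(1)] v(2) e show False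
    by (auto simp: algebra_simps)
qed

end

text \<open>Zorn's lemma for reverse inclusion; weak compactness keeps intersections of chains
  nonempty.\<close>

lemma minimal_invariant_set_exists:
  fixes K :: "'a::banach set"
  assumes refl: "reflexive_space TYPE('a)" and K: "K \<noteq> {}" "closed K" "bounded K" "convex K"
    and maps: "T \<in> K \<rightarrow> K" and nonexp: "\<And>x y. x \<in> K \<Longrightarrow> y \<in> K \<Longrightarrow> norm (T x - T y) \<le> norm (x - y)"
  obtains L where "L \<subseteq> K" "minimal_invariant_set L T"
proof -
  define A where "A = {L. L \<subseteq> K \<and> L \<noteq> {} \<and> closed L \<and> convex L \<and> T ` L \<subseteq> L}"
  obtain M where M: "\<And>x. x \<in> K \<Longrightarrow> norm x \<le> M" using K(3) by (auto simp: bounded_iff)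
  have KA: "K \<in> A" using K maps by (auto simp: A_def)
  have "\<exists>L\<in>A. \<forall>L'\<in>A. L \<supseteq> L' \<longrightarrow> L' = L"
  proof (rule predicate_Zorn)
    show "partial_order_on A (relation_of (\<lambda>x y. x \<supseteq> y) A)"
      by (rule partial_order_on_relation_ofI) auto
    fix Ch assume "Ch \<in> Chains (relation_of (\<lambda>x y. x \<supseteq> y) A)"
    hence Ch: "Ch \<subseteq> A" "\<And>C D. C \<in> Ch \<Longrightarrow> D \<in> Ch \<Longrightarrow> C \<subseteq> D \<or> D \<subseteq> C"
      by (auto simp: Chains_def relation_of_def)
    show "\<exists>u\<in>A. \<forall>a\<in>Ch. a \<supseteq> u"
    proof (cases "Ch = {}")
      case True
      thus ?thesis using KA by auto
    next
      case False
      have sub: "C \<subseteq> K" "closed C" "convex C" "C \<noteq> {}" "T ` C \<subseteq> C" if "C \<in> Ch" for C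
        using Ch(1) that by (auto simp: A_def)
      have "\<Inter>Ch \<noteq> {}"
      proof (rule reflexive_chain_Inter_nonempty[OF refl False Ch(2)])
        fix C assume C: "C \<in> Ch"
        have "C \<subseteq> cball 0 M" using sub(1)[OF C] M by auto
        thus "closed C \<and> convex C \<and> C \<noteq> {} \<and> C \<subseteq> cball 0 M" using sub(2-4)[OF C] by blast
      qed
      moreover have "\<Inter>Ch \<subseteq> K" using False sub(1) by blast
      moreover have "closed (\<Inter>Ch)" "convex (\<Inter>Ch)" using sub by (auto intro: convex_Inter)
      moreover have "T ` (\<Inter>Ch) \<subseteq> \<Inter>Ch" using sub(5) by blast
      ultimately have "\<Inter>Ch \<in> A" by (simp add: A_def)
      thus ?thesis by blast
    qed
  qed
  then obtain L where L: "L \<in> A" and min: "\<And>L'. L' \<in> A \<Longrightarrow> L' \<subseteq> L \<Longrightarrow> L' = L" by blast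
  have LK: "L \<subseteq> K" using L by (simp add: A_def)
  have "minimal_invariant_set L T"
  proof
    show "bounded L" using K(3) LK by (rule bounded_subset)
    show "L' = L" if "L' \<subseteq> L" "L' \<noteq> {}" "closed L'" "convex L'" "T ` L' \<subseteq> L'" for L'
      using that LK by (intro min) (auto simp: A_def)
    show "norm (T x - T y) \<le> norm (x - y)" if "x \<in> L" "y \<in> L" for x y
      using that LK by (intro nonexp) auto
  qed (use refl L in \<open>auto simp: A_def\<close>)
  thus ?thesis using that LK by blast
qed

theorem uniformly_nonsquare_imp_fixed_point_property:
  assumes uns: "uniformly_nonsquare TYPE('a::banach)"
  shows "fixed_point_property TYPE('a)"
  unfolding fixed_point_property_def
proof (intro allI impI)
  fix K :: "'a set" and T :: "'a \<Rightarrow> 'a"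
  assume K: "K \<noteq> {} \<and> closed K \<and> bounded K \<and> convex K \<and> T \<in> K \<rightarrow> K \<and>
    (\<forall>x\<in>K. \<forall>y\<in>K. norm (T x - T y) \<le> norm (x - y))"
  obtain L where L: "L \<subseteq> K" "minimal_invariant_set L T"
    using minimal_invariant_set_exists[OF uniformly_nonsquare_imp_reflexive[OF uns], of K T] K by blast
  interpret minimal_invariant_set L T by (rule L(2))
  obtain x where x: "x \<in> L" using K(1) by blast
  have "norm (T x - x) \<le> 0"
    using norm_le_diameter[OF maps[OF x] x] uniformly_nonsquare_diameter[OF uns] by simp
  thus "\<exists>x\<in>K. T x = x" using x L(1) by (intro bexI[of _ x]) auto
qed

section \<open>Power means of Birkhoff orthogonal vectors\<close>

lemma power_mean_commute: "power_mean t a b = power_mean t b a"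
  by (cases t) (simp_all add: power_mean_def ac_simps min.commute max.commute)

lemma power_mean_same: "0 < a \<Longrightarrow> power_mean t a a = a"
  by (cases t) (auto simp: power_mean_def powr_powr)

lemma power_mean_mono:
  assumes "0 < a" "a \<le> a'" "0 < b" "b \<le> b'"
  shows "power_mean t a b \<le> power_mean t a' b'"
proof (cases t)
  case (real r)
  consider "r = 0" | "r > 0" | "r < 0" by linarith
  thus ?thesis
  proof cases
    case 1
    thus ?thesis using assms real by (auto simp: power_mean_def intro!: mult_mono)
  next
    case 2
    hence "a powr r \<le> a' powr r" "b powr r \<le> b' powr r" using assms by (auto intro: powr_mono2)
    thus ?thesis using assms real 2 by (auto simp: power_mean_def intro!: powr_mono2 divide_right_mono)
  next
    case 3
    hence *: "a' powr r \<le> a powr r" "b' powr r \<le> b powr r" using assms by (auto intro: powr_mono2')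
    have "0 < a' powr r" "0 < b' powr r" using assms by auto
    hence "0 < (a' powr r + b' powr r) / 2" by (intro divide_pos_pos add_pos_pos) auto
    hence "((a powr r + b powr r) / 2) powr (1 / r) \<le> ((a' powr r + b' powr r) / 2) powr (1 / r)"
      using 3 * by (intro powr_mono2') auto
    thus ?thesis using real 3 by (simp add: power_mean_def)
  qed
qed (use assms in \<open>auto simp: power_mean_def\<close>)

text \<open>Strict monotonicity of powers settles each case. This strictness is what keeps
  \<open>JB\<close> below \<open>2\<close> at \<open>\<tau> = 1\<close>.\<close>

lemma power_mean_less:
  assumes "0 < b" "b < a" "t \<noteq> \<infinity>"
  shows "power_mean t a b < a"
proof (cases t)
  case (real r)
  have root: "(a powr r) powr (1 / r) = a" if "r \<noteq> 0" using that assms by (simp add: powr_powr)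
  consider "r = 0" | "r > 0" | "r < 0" by linarith
  thus ?thesis
  proof cases
    case 1
    have "sqrt (a * b) < sqrt (a * a)" using assms by (intro real_sqrt_less_mono) auto
    thus ?thesis using assms real 1 by (simp add: power_mean_def)
  next
    case 2
    hence "b powr r < a powr r" using assms by (auto intro: powr_less_mono2)
    hence "((a powr r + b powr r) / 2) powr (1 / r) < (a powr r) powr (1 / r)"
      using 2 by (intro powr_less_mono2) auto
    thus ?thesis using real 2 root by (simp add: power_mean_def)
  next
    case 3
    hence "a powr r < b powr r" using assms by (auto intro: powr_less_mono2_neg)
    hence "((a powr r + b powr r) / 2) powr (1 / r) < (a powr r) powr (1 / r)"
      using 3 assms by (intro powr_less_mono2_neg) auto
    thus ?thesis using real 3 root by (simp add: power_mean_def)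
  qed
qed (use assms in \<open>auto simp: power_mean_def\<close>)

lemma continuous_on_power_mean:
  assumes "continuous_on S f" "continuous_on S g" "\<And>x. x \<in> S \<Longrightarrow> 0 < f x" "\<And>x. x \<in> S \<Longrightarrow> 0 < g x"
  shows "continuous_on S (\<lambda>x. power_mean t (f x) (g x))"
proof (cases t)
  case (real r)
  have "f x powr r + g x powr r \<noteq> 0" if "x \<in> S" for x
    using assms(3,4)[OF that] by (metis add_pos_pos less_irrefl powr_gt_zero)
  thus ?thesis using assms(1,2) assms(3,4)[THEN less_imp_neq] real
    by (cases "r = 0") (auto simp: power_mean_def intro!: continuous_intros)
qed (use assms(1,2) in \<open>auto simp: power_mean_def intro!: continuous_intros\<close>)

section \<open>Birkhoff orthogonality from minimising the norm along a line\<close>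

text \<open>Outside the interval of radius \<open>R\<close> the norm is at least
  \<open>norm u\<close>, its value at \<open>c = 0\<close>, so the minimum over the interval is
  global.\<close>

lemma birkhoff_minimizer:
  fixes u v :: "'a::real_normed_vector"
  assumes v: "v \<noteq> 0"
  obtains l :: real where "\<And>c. norm (u + l *\<^sub>R v) \<le> norm (u + c *\<^sub>R v)"
proof -
  define R where "R = 2 * norm u / norm v"
  have R: "0 \<le> R" by (simp add: R_def)
  have "\<exists>l\<in>{-R..R}. \<forall>c\<in>{-R..R}. norm (u + l *\<^sub>R v) \<le> norm (u + c *\<^sub>R v)"
    using R by (intro continuous_attains_inf) (auto intro!: continuous_intros)
  then obtain l where l: "\<And>c. c \<in> {-R..R} \<Longrightarrow> norm (u + l *\<^sub>R v) \<le> norm (u + c *\<^sub>R v)" by blast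
  have "norm (u + l *\<^sub>R v) \<le> norm (u + c *\<^sub>R v)" for c
  proof (cases "c \<in> {-R..R}")
    case False
    hence "R < \<bar>c\<bar>" by auto
    hence "2 * norm u < \<bar>c\<bar> * norm v" using v by (simp add: R_def field_simps)
    hence "norm u \<le> norm (u + c *\<^sub>R v)"
      using norm_triangle_ineq4[of "u + c *\<^sub>R v" u] by simp
    thus ?thesis using l[of 0] R by simp
  qed (rule l)
  thus ?thesis using that by blast
qed

lemma birkhoff_orth_minimizer:
  assumes min: "\<And>c. norm (u + l *\<^sub>R v) \<le> norm (u + c *\<^sub>R v)"
  shows "birkhoff_orth (a *\<^sub>R (u + l *\<^sub>R v)) (b *\<^sub>R v)"
  unfolding birkhoff_orth_def
proof
  fix c
  show "norm (a *\<^sub>R (u + l *\<^sub>R v)) \<le> norm (a *\<^sub>R (u + l *\<^sub>R v) + c *\<^sub>R b *\<^sub>R v)"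
  proof (cases "a = 0")
    case False
    have "a *\<^sub>R (u + l *\<^sub>R v) + c *\<^sub>R b *\<^sub>R v = a *\<^sub>R (u + (l + c * b / a) *\<^sub>R v)"
      using False by (simp add: algebra_simps)
    thus ?thesis using min by (simp add: mult_left_mono)
  qed simp
qed

text \<open>The minimiser along a line is orthogonal to its direction, and independence makes it
  nonzero. Thus the suprema in \<open>JB\<close> are over nonempty sets.\<close>

lemma birkhoff_orth_exists:
  assumes "\<exists>B :: 'a::real_normed_vector set. independent B \<and> card B = 2"
  shows "\<exists>x y :: 'a. x \<in> sphere 0 1 \<and> y \<in> sphere 0 1 \<and> birkhoff_orth x y"
proof -
  obtain u v :: 'a where uv: "independent {u, v}" "u \<noteq> v" using assms by (auto simp: card_2_iff)
  have v: "v \<noteq> 0" using uv(1) dependent_zero by blast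
  obtain l where l: "\<And>c. norm (u + l *\<^sub>R v) \<le> norm (u + c *\<^sub>R v)" using birkhoff_minimizer[OF v] by blast
  have "u + l *\<^sub>R v \<noteq> 0"
  proof
    assume "u + l *\<^sub>R v = 0"
    hence "u = (- l) *\<^sub>R v" by (simp add: eq_neg_iff_add_eq_0)
    hence "u \<in> span {v}" by (metis span_base span_scale singletonI)
    thus False using uv by (simp add: independent_insert)
  qed
  thus ?thesis using birkhoff_orth_minimizer[OF l, of "1 / norm (u + l *\<^sub>R v)" "1 / norm v"] v
    by (intro exI conjI) (auto simp: dist_norm)
qed

text \<open>Normalise an almost square to unit vectors \<open>u\<close>, \<open>v\<close>, losing
  \<open>e\<close>. The minimal norm on the line through \<open>u\<close> along \<open>v\<close> is
  at most \<open>1\<close>, while \<open>low\<close> bounds it below by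
  \<open>1 + \<bar>l\<bar> - e\<close>; so \<open>\<bar>l\<bar> \<le> e\<close>, and the normalised
  minimiser \<open>p\<close> is within \<open>2 * e\<close> of \<open>u\<close>.\<close>

lemma not_uniformly_nonsquare_birkhoff:
  assumes nsq: "\<not> uniformly_nonsquare TYPE('a::real_normed_vector)" and e: "0 < e" "e < 1"
  shows "\<exists>x y :: 'a. x \<in> sphere 0 1 \<and> y \<in> sphere 0 1 \<and> birkhoff_orth x y \<and>
    2 - 3 * e \<le> norm (x + y) \<and> 2 - 3 * e \<le> norm (x - y)"
proof -
  obtain x y :: 'a where xy: "norm x \<le> 1" "norm y \<le> 1" "2 - e / 3 < norm (x + y)" "2 - e / 3 < norm (x - y)"
    using nsq e(1) unfolding uniformly_nonsquare_def by (metis divide_pos_pos not_less zero_less_numeral)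
  have n: "1 - e / 3 < norm x" "1 - e / 3 < norm y" using norm_triangle_ineq[of x y] xy by linarith+
  define u where "u = (1 / norm x) *\<^sub>R x"
  define v where "v = (1 / norm y) *\<^sub>R y"
  have pos: "0 < norm x" "0 < norm y" using n e by linarith+
  have u: "norm u = 1" and v: "norm v = 1" using pos by (auto simp: u_def v_def)
  have "u - x = (1 / norm x - 1) *\<^sub>R x" "v - y = (1 / norm y - 1) *\<^sub>R y"
    by (auto simp: u_def v_def algebra_simps)
  hence "norm (u - x) = \<bar>1 / norm x - 1\<bar> * norm x" "norm (v - y) = \<bar>1 / norm y - 1\<bar> * norm y" by simp_all
  moreover have "\<bar>1 / norm x - 1\<bar> = 1 / norm x - 1" "\<bar>1 / norm y - 1\<bar> = 1 / norm y - 1"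
    using pos xy by (auto simp: field_simps)
  ultimately have d: "norm (u - x) \<le> e / 3" "norm (v - y) \<le> e / 3"
    using pos n by (simp_all add: field_simps)
  have "norm (x + y) \<le> norm (u + v) + norm (u - x) + norm (v - y)"
    using norm_triangle_ineq4[of "u + v" "(u - x) + (v - y)"] norm_triangle_ineq[of "u - x" "v - y"]
    by (simp add: add.commute)
  hence sum: "2 - e < norm (u + v)" using xy d by linarith
  have "norm (x - y) \<le> norm (u - v) + norm (u - x) + norm (v - y)"
    using norm_triangle_ineq4[of "u - v" "(u - x) - (v - y)"] norm_triangle_ineq4[of "u - x" "v - y"] by simp
  hence diff: "2 - e < norm (u - v)" using xy d by linarith
  have low: "1 + c - e \<le> norm (u + c *\<^sub>R w)" if "0 \<le> c" "c \<le> 1" "norm w = 1" "2 - e < norm (u + w)" for c w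
  proof -
    have "u + w = (u + c *\<^sub>R w) + (1 - c) *\<^sub>R w" by (simp add: algebra_simps)
    hence "norm (u + w) \<le> norm (u + c *\<^sub>R w) + norm ((1 - c) *\<^sub>R w)" by (metis norm_triangle_ineq)
    thus ?thesis using that by simp
  qed
  \<comment> \<open>This covers the coefficients beyond the range of \<open>low\<close> and serves
    to exclude \<open>\<bar>l\<bar> > 1\<close>.\<close>
  have large: "1 < norm (u + c *\<^sub>R w)" if "1 < c" "norm w = 1" "2 - e < norm (u + w)" for c w
  proof -
    have "c *\<^sub>R (u + w) = (u + c *\<^sub>R w) + (c - 1) *\<^sub>R u" by (simp add: algebra_simps)
    hence "norm (c *\<^sub>R (u + w)) \<le> norm (u + c *\<^sub>R w) + norm ((c - 1) *\<^sub>R u)" by (metis norm_triangle_ineq)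
    hence "c * norm (u + w) \<le> norm (u + c *\<^sub>R w) + (c - 1)" using that u by simp
    moreover have "c * 1 < c * norm (u + w)" using that e by (intro mult_strict_left_mono) auto
    ultimately show ?thesis by linarith
  qed
  obtain l where l: "\<And>c. norm (u + l *\<^sub>R v) \<le> norm (u + c *\<^sub>R v)"
    using birkhoff_minimizer[of v] v by (metis norm_zero zero_neq_one)
  have l1: "norm (u + l *\<^sub>R v) \<le> 1" using l[of 0] u by simp
  define w where "w = (if 0 \<le> l then v else - v)"
  have w: "norm w = 1" "2 - e < norm (u + w)" "u + l *\<^sub>R v = u + \<bar>l\<bar> *\<^sub>R w" using v sum diff by (auto simp: w_def)
  have "\<bar>l\<bar> \<le> 1" using large[of "\<bar>l\<bar>" w] w l1 by force
  hence le: "1 + \<bar>l\<bar> - e \<le> norm (u + l *\<^sub>R v)" using low[of "\<bar>l\<bar>" w] w by simp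
  define s where "s = norm (u + l *\<^sub>R v)"
  have s: "0 < s" "1 - e \<le> s" "s \<le> 1" "\<bar>l\<bar> \<le> e" using le l1 e by (auto simp: s_def)
  define p where "p = (1 / s) *\<^sub>R (u + l *\<^sub>R v)"
  have p: "norm p = 1" using s by (simp add: p_def s_def)
  have "birkhoff_orth p v" using birkhoff_orth_minimizer[OF l, of "1 / s" 1] by (simp add: p_def)
  moreover have pu: "norm (p - u) \<le> 2 * e"
  proof -
    have "p - u = (1 / s - 1) *\<^sub>R (u + l *\<^sub>R v) + l *\<^sub>R v" by (simp add: p_def algebra_simps)
    hence "norm (p - u) \<le> norm ((1 / s - 1) *\<^sub>R (u + l *\<^sub>R v)) + norm (l *\<^sub>R v)" by (metis norm_triangle_ineq)
    also have "norm ((1 / s - 1) *\<^sub>R (u + l *\<^sub>R v)) = \<bar>1 / s - 1\<bar> * s"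
      by (simp only: norm_scaleR s_def)
    also have "\<bar>1 / s - 1\<bar> = 1 / s - 1" using s by (intro abs_of_nonneg) (simp add: field_simps)
    also have "(1 / s - 1) * s = 1 - s" using s by (simp add: field_simps)
    finally show ?thesis using s v by simp
  qed
  have "norm (u + v) \<le> norm (p + v) + norm (p - u)" "norm (u - v) \<le> norm (p - v) + norm (p - u)"
    using norm_triangle_ineq4[of "p + v" "p - u"] norm_triangle_ineq4[of "p - v" "p - u"] by (simp_all add: algebra_simps)
  hence "2 - 3 * e \<le> norm (p + v)" "2 - 3 * e \<le> norm (p - v)" using pu sum diff by linarith+
  ultimately show ?thesis using p v by (intro exI[of _ p] exI[of _ v]) (auto simp: dist_norm)
qed

section \<open>Bounds for \<open>JB\<close> and \<open>CB\<close>\<close>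

lemma birkhoff_orth_norm_bounds:
  assumes xy: "x \<in> sphere 0 1" "y \<in> sphere 0 1" "birkhoff_orth x y" and \<tau>: "0 \<le> \<tau>"
  shows "1 \<le> norm (x + \<tau> *\<^sub>R y)" "1 \<le> norm (x - \<tau> *\<^sub>R y)"
    "norm (x + \<tau> *\<^sub>R y) \<le> 1 + \<tau>" "norm (x - \<tau> *\<^sub>R y) \<le> 1 + \<tau>"
proof -
  have n: "norm x = 1" "norm y = 1" using xy by auto
  show "1 \<le> norm (x + \<tau> *\<^sub>R y)" using xy(3) n unfolding birkhoff_orth_def by metis
  have "norm x \<le> norm (x + (- \<tau>) *\<^sub>R y)" using xy(3) unfolding birkhoff_orth_def by blast
  thus "1 \<le> norm (x - \<tau> *\<^sub>R y)" using n by simp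
  show "norm (x + \<tau> *\<^sub>R y) \<le> 1 + \<tau>" "norm (x - \<tau> *\<^sub>R y) \<le> 1 + \<tau>"
    using norm_triangle_ineq[of x "\<tau> *\<^sub>R y"] norm_triangle_ineq4[of x "\<tau> *\<^sub>R y"] n \<tau> by simp_all
qed

lemma power_mean_le_1_plus:
  assumes "x \<in> sphere 0 1" "y \<in> sphere 0 1" "birkhoff_orth x y" "0 \<le> \<tau>"
  shows "power_mean t (norm (x + \<tau> *\<^sub>R y)) (norm (x - \<tau> *\<^sub>R y)) \<le> 1 + \<tau>"
proof -
  note b = birkhoff_orth_norm_bounds[OF assms]
  have "power_mean t (norm (x + \<tau> *\<^sub>R y)) (norm (x - \<tau> *\<^sub>R y)) \<le> power_mean t (1 + \<tau>) (1 + \<tau>)"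
    using b by (intro power_mean_mono) linarith+
  thus ?thesis using assms(4) by (simp add: power_mean_same)
qed

lemma power_mean_ge: "0 < m \<Longrightarrow> m \<le> a \<Longrightarrow> m \<le> b \<Longrightarrow> m \<le> power_mean t a b"
  using power_mean_mono[of m a m b t] power_mean_same[of m t] by simp

lemma power_mean_le_JB:
  fixes x y :: "'a::real_normed_vector"
  assumes xy: "x \<in> sphere 0 1" "y \<in> sphere 0 1" "birkhoff_orth x y" and \<tau>: "0 \<le> \<tau>"
  shows "power_mean t (norm (x + \<tau> *\<^sub>R y)) (norm (x - \<tau> *\<^sub>R y)) \<le> JB TYPE('a) t \<tau>"
  unfolding JB_def
proof (rule cSup_upper)
  show "bdd_above {power_mean t (norm (x + \<tau> *\<^sub>R y)) (norm (x - \<tau> *\<^sub>R y)) | x y :: 'a.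
            x \<in> sphere 0 1 \<and> y \<in> sphere 0 1 \<and> birkhoff_orth x y}"
    using power_mean_le_1_plus[OF _ _ _ \<tau>] by (intro bdd_aboveI[of _ "1 + \<tau>"]) blast
qed (use xy in blast)

lemma one_le_JB:
  fixes x y :: "'a::real_normed_vector"
  assumes "x \<in> sphere 0 1" "y \<in> sphere 0 1" "birkhoff_orth x y" "0 \<le> \<tau>"
  shows "1 \<le> JB TYPE('a) t \<tau>"
proof -
  have "1 \<le> power_mean t (norm (x + \<tau> *\<^sub>R y)) (norm (x - \<tau> *\<^sub>R y))"
    using birkhoff_orth_norm_bounds[OF assms] by (intro power_mean_ge) auto
  also have "\<dots> \<le> JB TYPE('a) t \<tau>" by (rule power_mean_le_JB[OF assms])
  finally show ?thesis .
qed

lemma JB_le: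
  assumes ex: "\<exists>x y :: 'a::real_normed_vector. x \<in> sphere 0 1 \<and> y \<in> sphere 0 1 \<and> birkhoff_orth x y"
    and le: "\<And>x y :: 'a. x \<in> sphere 0 1 \<Longrightarrow> y \<in> sphere 0 1 \<Longrightarrow> birkhoff_orth x y \<Longrightarrow>
      power_mean t (norm (x + \<tau> *\<^sub>R y)) (norm (x - \<tau> *\<^sub>R y)) \<le> B"
  shows "JB TYPE('a) t \<tau> \<le> B"
  unfolding JB_def using ex le by (intro cSup_least) blast+

theorem CB_less_2_iff:
  assumes dim: "\<exists>B :: 'a::real_normed_vector set. independent B \<and> card B = 2" and t: "t \<noteq> \<infinity>"
  shows "CB TYPE('a) t < 2 \<longleftrightarrow> uniformly_nonsquare TYPE('a)"
proof
  note ex = birkhoff_orth_exists[OF dim]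
  have J1: "1 \<le> JB TYPE('a) t \<tau>" if "0 \<le> \<tau>" for \<tau> using ex one_le_JB[OF _ _ _ that] by blast
  have J2: "JB TYPE('a) t \<tau> \<le> 1 + \<tau>" if "0 \<le> \<tau>" for \<tau>
    using that by (intro JB_le[OF ex] power_mean_le_1_plus)
  {
    assume CB: "CB TYPE('a) t < 2"
    \<comment> \<open>Boundedness lets the supremum \<open>CB\<close> dominate its term at
      \<open>\<tau> = 1\<close>, which gives \<open>JB TYPE('a) t 1 < 2\<close>.\<close>
    have "bdd_above ((\<lambda>\<tau>. (JB TYPE('a) t \<tau>)\<^sup>2 / (1 + \<tau>\<^sup>2)) ` {0..1})"
    proof (rule bdd_aboveI2)
      fix \<tau> :: real assume \<tau>: "\<tau> \<in> {0..1}"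
      have "(JB TYPE('a) t \<tau>)\<^sup>2 \<le> (1 + \<tau>)\<^sup>2" using J1[of \<tau>] J2[of \<tau>] \<tau> by (intro power_mono) auto
      also have "\<dots> \<le> 2\<^sup>2" using \<tau> by (intro power_mono) auto
      finally have "(JB TYPE('a) t \<tau>)\<^sup>2 \<le> 4 * 1" by simp
      also have "\<dots> \<le> 4 * (1 + \<tau>\<^sup>2)" by simp
      finally show "(JB TYPE('a) t \<tau>)\<^sup>2 / (1 + \<tau>\<^sup>2) \<le> 4"
        by (simp add: divide_le_eq add_pos_nonneg)
    qed
    hence "(JB TYPE('a) t 1)\<^sup>2 / (1 + 1\<^sup>2) \<le> CB TYPE('a) t"
      unfolding CB_def by (rule cSUP_upper[rotated]) auto
    hence "(JB TYPE('a) t 1)\<^sup>2 < 2\<^sup>2" using CB by simp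
    hence J: "JB TYPE('a) t 1 < 2" by (rule power2_less_imp_less) simp
    show "uniformly_nonsquare TYPE('a)"
    proof (rule ccontr)
      assume nsq: "\<not> uniformly_nonsquare TYPE('a)"
      \<comment> \<open>Then \<open>2 - 3 * e\<close> is the midpoint of \<open>2\<close> and
        \<open>JB TYPE('a) t 1\<close>.\<close>
      define e where "e = (2 - JB TYPE('a) t 1) / 6"
      have e: "0 < e" "e < 1" using J J1[of 1] by (auto simp: e_def)
      obtain x y :: 'a where xy: "x \<in> sphere 0 1" "y \<in> sphere 0 1" "birkhoff_orth x y"
        and ge: "2 - 3 * e \<le> norm (x + y)" "2 - 3 * e \<le> norm (x - y)"
        using not_uniformly_nonsquare_birkhoff[OF nsq e] by blast
      have "2 - 3 * e \<le> power_mean t (norm (x + 1 *\<^sub>R y)) (norm (x - 1 *\<^sub>R y))"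
        using ge J J1[of 1] by (intro power_mean_ge) (auto simp: e_def field_simps)
      also have "\<dots> \<le> JB TYPE('a) t 1" by (rule power_mean_le_JB[OF xy]) simp
      finally show False using J by (simp add: e_def field_simps)
    qed
  }
  {
    assume "uniformly_nonsquare TYPE('a)"
    then obtain \<delta> where \<delta>: "0 < \<delta>" "\<delta> \<le> 1" and sq: "\<And>r (x::'a) y. norm x \<le> r \<Longrightarrow> norm y \<le> r \<Longrightarrow>
       norm (x + y) \<le> (2 - \<delta>) * r \<or> norm (x - y) \<le> (2 - \<delta>) * r"
      using uniformly_nonsquare_scaled by blast
    \<comment> \<open>One of \<open>x + y\<close>, \<open>x - y\<close> has norm at most
      \<open>2 - \<delta>\<close>; interpolation with \<open>x\<close> bounds the corresponding norm
      at \<open>\<tau>\<close> by \<open>1 + \<tau> - \<tau> * \<delta>\<close>, and the other is at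
      most \<open>1 + \<tau>\<close>.\<close>
    define m where "m \<tau> = power_mean t (1 + \<tau>) (1 + \<tau> - \<tau> * \<delta>)" for \<tau>
    have pos: "0 < 1 + \<tau> - \<tau> * \<delta>" if "0 \<le> \<tau>" for \<tau>
    proof -
      have "\<tau> * \<delta> \<le> \<tau> * 1" using that \<delta> by (intro mult_left_mono) auto
      thus ?thesis by simp
    qed
    have Jm: "JB TYPE('a) t \<tau> \<le> m \<tau>" if \<tau>: "0 \<le> \<tau>" "\<tau> \<le> 1" for \<tau>
    proof (rule JB_le[OF ex])
      fix x y :: 'a assume xy: "x \<in> sphere 0 1" "y \<in> sphere 0 1" "birkhoff_orth x y"
      note b = birkhoff_orth_norm_bounds[OF xy \<tau>(1)]
      have *: "norm (x + \<tau> *\<^sub>R z) \<le> 1 + \<tau> - \<tau> * \<delta>" if "norm (x + z) \<le> 2 - \<delta>" for z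
      proof -
        have "x + \<tau> *\<^sub>R z = (1 - \<tau>) *\<^sub>R x + \<tau> *\<^sub>R (x + z)" by (simp add: algebra_simps)
        hence "norm (x + \<tau> *\<^sub>R z) \<le> norm ((1 - \<tau>) *\<^sub>R x) + norm (\<tau> *\<^sub>R (x + z))" by (metis norm_triangle_ineq)
        also have "\<dots> \<le> (1 - \<tau>) + \<tau> * (2 - \<delta>)" using \<tau> xy(1) that by (auto intro!: mult_left_mono)
        finally show ?thesis by (simp add: algebra_simps)
      qed
      have "norm (x + y) \<le> 2 - \<delta> \<or> norm (x - y) \<le> 2 - \<delta>" using sq[of x 1 y] xy by simp
      thus "power_mean t (norm (x + \<tau> *\<^sub>R y)) (norm (x - \<tau> *\<^sub>R y)) \<le> m \<tau>"
      proof
        assume "norm (x + y) \<le> 2 - \<delta>"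
        from *[OF this] show ?thesis unfolding m_def power_mean_commute[of t "1 + \<tau>"]
          using b by (intro power_mean_mono) auto
      next
        assume "norm (x - y) \<le> 2 - \<delta>"
        with *[of "- y"] show ?thesis unfolding m_def
          using b by (intro power_mean_mono) auto
      qed
    qed
    \<comment> \<open>The maximum is attained, so a strict inequality at the single point
      \<open>\<sigma>\<close> suffices.\<close>
    have "\<exists>\<sigma>\<in>{0..1}. \<forall>\<tau>\<in>{0..1}. (m \<tau>)\<^sup>2 / (1 + \<tau>\<^sup>2) \<le> (m \<sigma>)\<^sup>2 / (1 + \<sigma>\<^sup>2)"
    proof (rule continuous_attains_sup)
      have "1 + \<tau>\<^sup>2 \<noteq> 0" for \<tau> :: real by (metis add_pos_nonneg less_irrefl zero_le_power2 zero_less_one)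
      thus "continuous_on {0..1} (\<lambda>\<tau>. (m \<tau>)\<^sup>2 / (1 + \<tau>\<^sup>2))"
        unfolding m_def using pos by (intro continuous_intros continuous_on_power_mean) auto
    qed auto
    then obtain \<sigma> where \<sigma>: "0 \<le> \<sigma>" "\<sigma> \<le> 1"
      and max: "\<And>\<tau>. 0 \<le> \<tau> \<Longrightarrow> \<tau> \<le> 1 \<Longrightarrow> (m \<tau>)\<^sup>2 / (1 + \<tau>\<^sup>2) \<le> (m \<sigma>)\<^sup>2 / (1 + \<sigma>\<^sup>2)" by auto
    have m1: "1 \<le> m \<sigma>" using J1[OF \<sigma>(1)] Jm[OF \<sigma>] by simp
    have "CB TYPE('a) t \<le> (m \<sigma>)\<^sup>2 / (1 + \<sigma>\<^sup>2)"
      unfolding CB_def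
    proof (rule cSUP_least)
      fix \<tau> :: real assume \<tau>: "\<tau> \<in> {0..1}"
      have "(JB TYPE('a) t \<tau>)\<^sup>2 \<le> (m \<tau>)\<^sup>2" using Jm[of \<tau>] J1[of \<tau>] \<tau> by (intro power_mono) auto
      hence "(JB TYPE('a) t \<tau>)\<^sup>2 / (1 + \<tau>\<^sup>2) \<le> (m \<tau>)\<^sup>2 / (1 + \<tau>\<^sup>2)" by (intro divide_right_mono) auto
      thus "(JB TYPE('a) t \<tau>)\<^sup>2 / (1 + \<tau>\<^sup>2) \<le> (m \<sigma>)\<^sup>2 / (1 + \<sigma>\<^sup>2)" using max[of \<tau>] \<tau> by auto
    qed auto
    also have "\<dots> < 2"
    proof -
      \<comment> \<open>For \<open>\<sigma> \<noteq> 1\<close> the trivial bound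
        \<open>(1 + \<sigma>)\<^sup>2\<close> is already below the right-hand side, by
        \<open>(1 - \<sigma>)\<^sup>2\<close>; non-squareness enters only at
        \<open>\<sigma> = 1\<close>.\<close>
      have "(m \<sigma>)\<^sup>2 < 2 * (1 + \<sigma>\<^sup>2)"
      proof (cases "\<sigma> = 1")
        case True
        have "m \<sigma> < 2" using power_mean_less[of "2 - \<delta>" 2 t] \<delta> t True by (simp add: m_def)
        hence "(m \<sigma>)\<^sup>2 < 2\<^sup>2" using m1 by (intro power_strict_mono) auto
        thus ?thesis using True by simp
      next
        case False
        have "m \<sigma> \<le> power_mean t (1 + \<sigma>) (1 + \<sigma>)"
          unfolding m_def using \<sigma> \<delta> pos[of \<sigma>] by (intro power_mean_mono) auto
        hence "(m \<sigma>)\<^sup>2 \<le> (1 + \<sigma>)\<^sup>2" using m1 \<sigma> by (intro power_mono) (auto simp: power_mean_same)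
        moreover have "0 < (1 - \<sigma>)\<^sup>2" using False by simp
        ultimately show ?thesis by (simp add: power2_eq_square algebra_simps)
      qed
      moreover have "0 < 1 + \<sigma>\<^sup>2" by (simp add: add_pos_nonneg)
      ultimately show ?thesis by (simp add: divide_less_eq)
    qed
    finally show "CB TYPE('a) t < 2" .
  }
qed

theorem corollary7:
  assumes "\<exists>B :: 'a::banach set. independent B \<and> card B = 2"
  shows "((\<exists>t\<in>{-\<infinity>..<\<infinity>}. CB TYPE('a) t < 2) \<longleftrightarrow> (\<forall>t\<in>{-\<infinity>..<\<infinity>}. CB TYPE('a) t < 2)) \<and>
         ((\<exists>t\<in>{-\<infinity>..<\<infinity>}. CB TYPE('a) t < 2) \<longrightarrow>
            super_reflexive TYPE('a) TYPE('b::banach) \<and> fixed_point_property TYPE('a))"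
proof -
  have CB: "CB TYPE('a) t < 2 \<longleftrightarrow> uniformly_nonsquare TYPE('a)" if "t \<in> {-\<infinity>..<\<infinity>}" for t
    using that by (intro CB_less_2_iff[OF assms]) auto
  \<comment> \<open>The index set is nonempty, so both quantifiers agree for a condition independent
    of \<open>t\<close>.\<close>
  have "(0::ereal) \<in> {-\<infinity>..<\<infinity>}" by simp
  hence "(\<exists>t\<in>{-\<infinity>..<\<infinity>}. CB TYPE('a) t < 2) \<longleftrightarrow> uniformly_nonsquare TYPE('a)"
    and "(\<forall>t\<in>{-\<infinity>..<\<infinity>}. CB TYPE('a) t < 2) \<longleftrightarrow> uniformly_nonsquare TYPE('a)"
    using CB by blast+
  moreover have "super_reflexive TYPE('a) TYPE('b)" if "uniformly_nonsquare TYPE('a)"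
    unfolding super_reflexive_def
    using uniformly_nonsquare_imp_reflexive[OF uniformly_nonsquare_finitely_representable[OF that]] by blast
  ultimately show ?thesis using uniformly_nonsquare_imp_fixed_point_property by blast
qed

end
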